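(* Let $V,W$ be in $\mathcal{O}_{q^{-1}}$ and consider the flip $\tau:V\otimes W\to W\otimes V$, $\tau(v\otimes w)=w\otimes v$. Then $\tau$ induces a $U_q(\mathfrak{b})$-linear isomorphism $\mathcal{F}_q(V)\otimes\mathcal{F}_q(W)\to\mathcal{F}_q(W\otimes V)$.
   Context: Algebras. Let $q=e^{h}\in\mathbb{C}^{\times}$ ($h\in\mathbb{C}$) be not a root of unity and $q^r:=e^{hr}$. Everything is over $\mathbb{C}$; $\mathbb{N}=\mathbb{Z}_{\ge 0}$. Let $C=(C_{i,j})_{0\le i,j\le n}$ be an indecomposable Cartan matrix of untwisted affine type, with affine Kac--Moody algebra $\mathfrak{g}$; $d_0,\dots,d_n$ relatively prime positive integers with $(d_iC_{i,j})$ symmetric; $a_0=1,a_1,\dots,a_n\in\mathbb{N}$ relatively prime with $C(a_0,\dots,a_n)^T=0$; $q_i=q^{d_i}$; $I=\{1,\dots,n\}$; $[m]_x=\frac{x^m-x^{-m}}{x-x^{-1}}$, $[m]_x!=\prod_{r=1}^m[r]_x$. The quantum loop algebra $U_q(\mathfrak{g})$ is generated by $\{e_i,f_i,k_i^{\pm1}\}_{i=0}^n$ with relations $k_ik_j=k_jk_i$, $k_i^{\pm1}k_i^{\mp1}=1=k_0^{a_0}\cdots k_n^{a_n}$, $k_ie_jk_i^{-1}=q_i^{C_{i,j}}e_j$, $k_if_jk_i^{-1}=q_i^{-C_{i,j}}f_j$, $[e_i,f_j]=\delta_{i,j}\frac{k_i-k_i^{-1}}{q_i-q_i^{-1}}$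 and, for $i\ne j$, $\sum_{r=0}^{1-C_{i,j}}(-1)^r x_i^{(1-C_{i,j}-r)}x_jx_i^{(r)}=0$ for $x=e$ and for $x=f$, where $x_i^{(r)}=x_i^r/[r]_{q_i}!$. Coproduct: $\Delta(e_i)=e_i\otimes1+k_i\otimes e_i$, $\Delta(f_i)=f_i\otimes k_i^{-1}+1\otimes f_i$, $\Delta(k_i)=k_i\otimes k_i$. The Borel subalgebra $U_q(\mathfrak{b})$ is the (Hopf) subalgebra generated by $\{e_i,k_i^{\pm1}\}_{i=0}^n$. $U_{q^{-1}}(\mathfrak{g})$, $U_{q^{-1}}(\mathfrak{b})$ are the same with $q$ replaced by $q^{-1}$. Category $\mathcal{O}$. Let $\mathfrak{t}^\times=(\mathbb{C}^\times)^I$. For a $U_q(\mathfrak{b})$-module $V$ and $\mu\in\mathfrak{t}^\times$ put $V_\mu=\{v\in V: k_iv=\mu_iv\ \forall i\in I\}$, $P(V)=\{\mu:V_\mu\neq0\}$. Let $\alpha_i,\omega_i$ ($i\in I$) be the simple roots and fundamental weights of the simple Lie algebra with Cartan matrix $(C_{i,j})_{i,j\in I}$ ($\alpha_i=\sum_jC_{j,i}\omega_j$), $Q^+=\bigoplus\mathbb{N}\alpha_i$, $P_{\mathbb{Q}}=\bigoplus\mathbb{Q}\omega_i$, and $\omega\mapsto\overline{\omega}$ the injective group morphism $P_{\mathbb{Q}}\to\mathfrak{t}^\times$ with $\overline{\omega_i}=(q_i^{\delta_{ij}})_{j\in I}$. Write $\mu\le\nu$ iff $\nu\mu^{-1}\in\overline{Q^+}$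 and $D(\lambda)=\{\mu:\mu\le\lambda\}$. $\mathcal{O}_q$ is the full monoidal subcategory of $U_q(\mathfrak{b})$-modules $V$ with $V=\bigoplus_\mu V_\mu$, $\dim V_\mu<\infty$, $P(V)\subseteq\bigcup_{i=1}^sD(\lambda_i)$ for some $\lambda_1,\dots,\lambda_s$. $\mathcal{O}_{q^{-1}}$ is the analogue for $U_{q^{-1}}(\mathfrak{b})$ with $q$ replaced by $q^{-1}$ everywhere (including in the order). Functor $\mathcal{F}_q$. There is an algebra isomorphism $\sigma_q:U_q(\mathfrak{g})\to U_{q^{-1}}(\mathfrak{g})$ with $\sigma_q(e_i)=-k_i^{-1}e_i$, $\sigma_q(f_i)=-f_ik_i$, $\sigma_q(k_i)=k_i^{-1}$ for $0\le i\le n$; it restricts to $U_q(\mathfrak{b})\simeq U_{q^{-1}}(\mathfrak{b})$. $\mathcal{F}_q:\mathcal{O}_{q^{-1}}\to\mathcal{O}_q$ is pullback of modules along $\sigma_q$, so $\mathcal{F}_q(V)=V$ as a vector space. *)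

theory Defs
  imports
    Complex_Main
    "HOL-Library.Poly_Mapping"
    "HOL-Algebra.QuotRing"
    "HOL-Algebra.Generated_Rings"
    "HOL-Algebra.Algebraic_Closure_Type"
begin

section \<open>Untwisted affine Cartan matrices\<close>

text \<open>
  The finite type \<open>'i\<close> plays the role of \<open>I = {1,\<dots>,n}\<close> (so \<open>n = CARD('i) \<ge> 1\<close>), and \<open>'i option\<close>
  that of \<open>{0,\<dots>,n}\<close>: \<open>None\<close> is the affine node \<open>0\<close> and \<open>Some i\<close> is \<open>i \<in> I\<close>.
\<close>

definition gen_cartan_matrix :: "('k \<Rightarrow> 'k \<Rightarrow> int) \<Rightarrow> bool" where
  "gen_cartan_matrix C \<longleftrightarrow>
     (\<forall>i. C i i = 2) \<and> (\<forall>i j. i \<noteq> j \<longrightarrow> C i j \<le> 0) \<and> (\<forall>i j. C i j = 0 \<longrightarrow> C j i = 0)"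

definition indecomposable :: "('k \<Rightarrow> 'k \<Rightarrow> int) \<Rightarrow> bool" where
  "indecomposable C \<longleftrightarrow> (\<forall>J. J \<noteq> {} \<and> J \<noteq> UNIV \<longrightarrow> (\<exists>i\<in>J. \<exists>j\<in>-J. C i j \<noteq> 0))"

text \<open>Type (Aff) in Kac's trichotomy; the second conjunct says that \<open>C\<close> has corank one.\<close>

definition affine_type :: "('k::finite \<Rightarrow> 'k \<Rightarrow> int) \<Rightarrow> bool" where
  "affine_type C \<longleftrightarrow>
     (\<exists>u :: 'k \<Rightarrow> real. (\<forall>i. 0 < u i) \<and> (\<forall>i. (\<Sum>j\<in>UNIV. C i j * u j) = 0) \<and>
        (\<forall>v. (\<forall>i. (\<Sum>j\<in>UNIV. C i j * v j) = 0) \<longrightarrow> (\<exists>c. \<forall>i. v i = c * u i))) \<and>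
     (\<forall>v :: 'k \<Rightarrow> real. (\<forall>i. 0 \<le> (\<Sum>j\<in>UNIV. C i j * v j)) \<longrightarrow> (\<forall>i. (\<Sum>j\<in>UNIV. C i j * v j) = 0))"

text \<open>
  Roots of the simple Lie algebra with Cartan matrix \<open>(C\<^sub>i\<^sub>j)\<close>, \<open>i, j \<in> I\<close>, in coordinates with
  respect to the simple roots: the closure of the simple roots under the simple reflections
  \<open>s\<^sub>i \<beta> = \<beta> - \<langle>\<alpha>\<^sub>i\<^sup>\<or>, \<beta>\<rangle> \<alpha>\<^sub>i\<close>, where \<open>\<langle>\<alpha>\<^sub>i\<^sup>\<or>, \<alpha>\<^sub>j\<rangle> = C\<^sub>i\<^sub>j\<close>.
\<close>

inductive_set finite_roots :: "('i::finite option \<Rightarrow> 'i option \<Rightarrow> int) \<Rightarrow> ('i \<Rightarrow> int) set"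
  for C where
  simple: "(\<lambda>j. if j = i then 1 else 0) \<in> finite_roots C"
| reflect: "\<beta> \<in> finite_roots C \<Longrightarrow>
    \<beta>(i := \<beta> i - (\<Sum>j\<in>UNIV. C (Some i) (Some j) * \<beta> j)) \<in> finite_roots C"

definition highest_root :: "('i::finite option \<Rightarrow> 'i option \<Rightarrow> int) \<Rightarrow> ('i \<Rightarrow> int) \<Rightarrow> bool" where
  "highest_root C \<theta> \<longleftrightarrow> \<theta> \<in> finite_roots C \<and> (\<forall>\<beta>\<in>finite_roots C. \<forall>j. \<beta> j \<le> \<theta> j)"

text \<open>
  An affine matrix is untwisted (with affine node \<open>0\<close>) if it is the extended Cartan matrix of its
  finite part, i.e. if \<open>\<alpha>\<^sub>0\<close> and \<open>\<alpha>\<^sub>0\<^sup>\<or>\<close> act on \<open>I\<close> as \<open>-\<theta>\<close> and \<open>-\<theta>\<^sup>\<or>\<close> for the highest root \<open>\<theta>\<close>: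
  \<open>C\<^sub>i\<^sub>0 = -\<langle>\<alpha>\<^sub>i\<^sup>\<or>, \<theta>\<rangle>\<close> and \<open>C\<^sub>0\<^sub>j = -2 (\<theta>, \<alpha>\<^sub>j) / (\<theta>, \<theta>)\<close>, with \<open>(\<alpha>\<^sub>i, \<alpha>\<^sub>j) = d\<^sub>i C\<^sub>i\<^sub>j\<close>.
\<close>

definition untwisted :: "('i::finite option \<Rightarrow> 'i option \<Rightarrow> int) \<Rightarrow> ('i option \<Rightarrow> nat) \<Rightarrow> bool" where
  "untwisted C d \<longleftrightarrow> (\<exists>\<theta>. highest_root C \<theta> \<and>
     (\<forall>i. C (Some i) None = - (\<Sum>j\<in>UNIV. C (Some i) (Some j) * \<theta> j)) \<and>
     (\<forall>j. C None (Some j) * (\<Sum>k\<in>UNIV. \<Sum>l\<in>UNIV. d (Some k) * C (Some k) (Some l) * \<theta> k * \<theta> l)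
          = - 2 * (\<Sum>k\<in>UNIV. \<theta> k * (d (Some k) * C (Some k) (Some j)))))"

definition untwisted_affine_datum ::
    "('i::finite option \<Rightarrow> 'i option \<Rightarrow> int) \<Rightarrow> ('i option \<Rightarrow> nat) \<Rightarrow> ('i option \<Rightarrow> nat) \<Rightarrow> bool" where
  "untwisted_affine_datum C d a \<longleftrightarrow>
     gen_cartan_matrix C \<and> indecomposable C \<and> affine_type C \<and> untwisted C d \<and>
     (\<forall>i. 0 < d i) \<and> Gcd (range d) = 1 \<and> (\<forall>i j. d i * C i j = d j * C j i) \<and>
     a None = 1 \<and> Gcd (range a) = 1 \<and> (\<forall>i. (\<Sum>j\<in>UNIV. C i j * int (a j)) = 0)"


section \<open>Associative algebras over the complex numbers, modules and tensor products\<close>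

text \<open>
  Vector spaces and (noncommutative) algebras over the complex numbers are both \<open>module\<close> records
  over the following ring; for vector spaces the fields \<open>mult\<close> and \<open>one\<close> are ignored.
\<close>

abbreviation complex_ring :: "complex ring" where
  "complex_ring \<equiv> ring_of_type_algebra"

definition alg_hom ::
    "(complex, 'a, 'x) module_scheme \<Rightarrow> (complex, 'b, 'y) module_scheme \<Rightarrow> ('a \<Rightarrow> 'b) set" where
  "alg_hom A B = {f \<in> ring_hom A B. \<forall>c. \<forall>x\<in>carrier A. f (c \<odot>\<^bsub>A\<^esub> x) = c \<odot>\<^bsub>B\<^esub> f x}"

definition alg_iso ::
    "(complex, 'a, 'x) module_scheme \<Rightarrow> (complex, 'b, 'y) module_scheme \<Rightarrow> ('a \<Rightarrow> 'b) set" where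
  "alg_iso A B = {f \<in> alg_hom A B. bij_betw f (carrier A) (carrier B)}"

text \<open>The underlying ring is the library's \<open>A Quot J\<close>; only the scalar multiplication is added.\<close>

definition quot_alg ::
    "(complex, 'a, 'x) module_scheme \<Rightarrow> 'a set \<Rightarrow> (complex, 'a set) module" where
  "quot_alg A J = ring.extend (A Quot J)
     (module.fields (\<lambda>c Y. \<Union>x\<in>Y. J +>\<^bsub>A\<^esub> (c \<odot>\<^bsub>A\<^esub> x)))"

definition generate_alg :: "(complex, 'a, 'x) module_scheme \<Rightarrow> 'a set \<Rightarrow> 'a set" where
  "generate_alg A H = generate_ring A (range (\<lambda>c. c \<odot>\<^bsub>A\<^esub> \<one>\<^bsub>A\<^esub>) \<union> H)"

record ('u, 'v) amodule = "(complex, 'v) module" +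
  act :: "'u \<Rightarrow> 'v \<Rightarrow> 'v"

definition alg_module ::
    "(complex, 'u, 'x) module_scheme \<Rightarrow> ('u, 'v, 'z) amodule_scheme \<Rightarrow> bool" where
  "alg_module A V \<longleftrightarrow> Module.module complex_ring V \<and>
     (\<forall>x\<in>carrier A. \<forall>v\<in>carrier V. act V x v \<in> carrier V) \<and>
     (\<forall>x\<in>carrier A. \<forall>v\<in>carrier V. \<forall>w\<in>carrier V. act V x (v \<oplus>\<^bsub>V\<^esub> w) = act V x v \<oplus>\<^bsub>V\<^esub> act V x w) \<and>
     (\<forall>x\<in>carrier A. \<forall>y\<in>carrier A. \<forall>v\<in>carrier V. act V (x \<oplus>\<^bsub>A\<^esub> y) v = act V x v \<oplus>\<^bsub>V\<^esub> act V y v) \<and>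
     (\<forall>c. \<forall>x\<in>carrier A. \<forall>v\<in>carrier V. act V x (c \<odot>\<^bsub>V\<^esub> v) = c \<odot>\<^bsub>V\<^esub> act V x v) \<and>
     (\<forall>c. \<forall>x\<in>carrier A. \<forall>v\<in>carrier V. act V (c \<odot>\<^bsub>A\<^esub> x) v = c \<odot>\<^bsub>V\<^esub> act V x v) \<and>
     (\<forall>x\<in>carrier A. \<forall>y\<in>carrier A. \<forall>v\<in>carrier V. act V (x \<otimes>\<^bsub>A\<^esub> y) v = act V x (act V y v)) \<and>
     (\<forall>v\<in>carrier V. act V \<one>\<^bsub>A\<^esub> v = v)"

definition amodule_iso ::
    "(complex, 'u, 'x) module_scheme \<Rightarrow> ('u, 'v, 'y) amodule_scheme \<Rightarrow> ('u, 'w, 'z) amodule_scheme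
      \<Rightarrow> ('v \<Rightarrow> 'w) \<Rightarrow> bool" where
  "amodule_iso A M N f \<longleftrightarrow> alg_module A M \<and> alg_module A N \<and>
     bij_betw f (carrier M) (carrier N) \<and>
     (\<forall>v\<in>carrier M. \<forall>w\<in>carrier M. f (v \<oplus>\<^bsub>M\<^esub> w) = f v \<oplus>\<^bsub>N\<^esub> f w) \<and>
     (\<forall>c. \<forall>v\<in>carrier M. f (c \<odot>\<^bsub>M\<^esub> v) = c \<odot>\<^bsub>N\<^esub> f v) \<and>
     (\<forall>x\<in>carrier A. \<forall>v\<in>carrier M. f (act M x v) = act N x (f v))"

definition pullback :: "('u \<Rightarrow> 'u) \<Rightarrow> ('u, 'v) amodule \<Rightarrow> ('u, 'v) amodule" where
  "pullback \<sigma> V = V\<lparr>act := (\<lambda>x. act V (\<sigma> x))\<rparr>"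

text \<open>
  \<open>A \<otimes> B\<close> is the free vector space on \<open>carrier A \<times> carrier B\<close> modulo the span of the bilinearity
  relations. If \<open>A\<close> and \<open>B\<close> are algebras, it carries the product
  \<open>(a \<otimes> b) (a' \<otimes> b') = a a' \<otimes> b b'\<close>; for mere vector spaces \<open>mult\<close> and \<open>one\<close> are meaningless.
\<close>

abbreviation pm_scale :: "complex \<Rightarrow> ('a \<Rightarrow>\<^sub>0 complex) \<Rightarrow> 'a \<Rightarrow>\<^sub>0 complex" where
  "pm_scale c \<equiv> Poly_Mapping.map ((*) c)"

definition pm_bilinear ::
    "('a \<Rightarrow> 'b \<Rightarrow> 'c) \<Rightarrow> ('a \<Rightarrow>\<^sub>0 complex) \<Rightarrow> ('b \<Rightarrow>\<^sub>0 complex) \<Rightarrow> ('c \<Rightarrow>\<^sub>0 complex)" where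
  "pm_bilinear f p r = (\<Sum>x\<in>Poly_Mapping.keys p. \<Sum>y\<in>Poly_Mapping.keys r.
     Poly_Mapping.single (f x y) (Poly_Mapping.lookup p x * Poly_Mapping.lookup r y))"

definition free_tensor ::
    "(complex, 'a, 'x) module_scheme \<Rightarrow> (complex, 'b, 'y) module_scheme
      \<Rightarrow> (complex, 'a \<times> 'b \<Rightarrow>\<^sub>0 complex) module" where
  "free_tensor A B =
    \<lparr>carrier = {p. Poly_Mapping.keys p \<subseteq> carrier A \<times> carrier B},
     monoid.mult = pm_bilinear (\<lambda>(a, b) (a', b'). (a \<otimes>\<^bsub>A\<^esub> a', b \<otimes>\<^bsub>B\<^esub> b')),
     one = Poly_Mapping.single (\<one>\<^bsub>A\<^esub>, \<one>\<^bsub>B\<^esub>) 1,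
     zero = 0, add = (+), module.smult = pm_scale\<rparr>"

definition bilinear_rels ::
    "(complex, 'a, 'x) module_scheme \<Rightarrow> (complex, 'b, 'y) module_scheme
      \<Rightarrow> ('a \<times> 'b \<Rightarrow>\<^sub>0 complex) set" where
  "bilinear_rels A B = (let s = (\<lambda>x y. Poly_Mapping.single (x, y) (1::complex)) in
     {s (x \<oplus>\<^bsub>A\<^esub> x') y - s x y - s x' y |x x' y. x \<in> carrier A \<and> x' \<in> carrier A \<and> y \<in> carrier B} \<union>
     {s x (y \<oplus>\<^bsub>B\<^esub> y') - s x y - s x y' |x y y'. x \<in> carrier A \<and> y \<in> carrier B \<and> y' \<in> carrier B} \<union>
     {s (c \<odot>\<^bsub>A\<^esub> x) y - pm_scale c (s x y) |c x y. x \<in> carrier A \<and> y \<in> carrier B} \<union>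
     {s x (c \<odot>\<^bsub>B\<^esub> y) - pm_scale c (s x y) |c x y. x \<in> carrier A \<and> y \<in> carrier B})"

definition tensor_null ::
    "(complex, 'a, 'x) module_scheme \<Rightarrow> (complex, 'b, 'y) module_scheme
      \<Rightarrow> ('a \<times> 'b \<Rightarrow>\<^sub>0 complex) set" where
  "tensor_null A B = Modules.module.span pm_scale (bilinear_rels A B)"

definition tensor ::
    "(complex, 'a, 'x) module_scheme \<Rightarrow> (complex, 'b, 'y) module_scheme
      \<Rightarrow> (complex, ('a \<times> 'b \<Rightarrow>\<^sub>0 complex) set) module" where
  "tensor A B = quot_alg (free_tensor A B) (tensor_null A B)"

definition pure_tensor ::
    "(complex, 'a, 'x) module_scheme \<Rightarrow> (complex, 'b, 'y) module_scheme
      \<Rightarrow> 'a \<Rightarrow> 'b \<Rightarrow> ('a \<times> 'b \<Rightarrow>\<^sub>0 complex) set" where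
  "pure_tensor A B x y =
     tensor_null A B +>\<^bsub>free_tensor A B\<^esub> Poly_Mapping.single (x, y) 1"

text \<open>
  The flip \<open>\<tau>\<close>, swapping the two components in every representative of a class; see
  \<open>flip_pure_tensor\<close> below.
\<close>

definition flip :: "('a \<times> 'b \<Rightarrow>\<^sub>0 complex) set \<Rightarrow> ('b \<times> 'a \<Rightarrow>\<^sub>0 complex) set" where
  "flip T = Poly_Mapping.map_key prod.swap ` T"

text \<open>
  Let \<open>\<Delta> : U \<rightarrow> U \<otimes> U\<close> restrict to \<open>B \<rightarrow> B \<otimes> B\<close> for a subalgebra \<open>B\<close>. The inclusion
  \<open>B \<otimes> B \<rightarrow> U \<otimes> U\<close> enlarges cosets, so for \<open>x \<in> B\<close> the element of \<open>B \<otimes> B\<close> representing \<open>\<Delta> x\<close>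
  consists of those members of the coset \<open>\<Delta> x\<close> that are supported on \<open>B \<times> B\<close>.
\<close>

definition restrict_coproduct ::
    "(complex, 'u, 'x) module_scheme \<Rightarrow> ('u \<Rightarrow> ('u \<times> 'u \<Rightarrow>\<^sub>0 complex) set)
      \<Rightarrow> 'u \<Rightarrow> ('u \<times> 'u \<Rightarrow>\<^sub>0 complex) set" where
  "restrict_coproduct B \<Delta> x = \<Delta> x \<inter> carrier (free_tensor B B)"

text \<open>
  \<open>V \<otimes> W\<close>, on which \<open>x \<in> B\<close> acts as the element \<open>\<Delta> x\<close> of \<open>B \<otimes> B\<close>, where
  \<open>(b \<otimes> b') (v \<otimes> w) = b v \<otimes> b' w\<close>.
\<close>

definition tensor_amodule ::
    "('u \<Rightarrow> ('u \<times> 'u \<Rightarrow>\<^sub>0 complex) set) \<Rightarrow> ('u, 'v) amodule \<Rightarrow> ('u, 'w) amodule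
      \<Rightarrow> ('u, ('v \<times> 'w \<Rightarrow>\<^sub>0 complex) set) amodule" where
  "tensor_amodule \<Delta> V W = module.extend (tensor V W)
     (amodule.fields (\<lambda>x T. \<Union>p\<in>\<Delta> x. \<Union>r\<in>T. tensor_null V W +>\<^bsub>free_tensor V W\<^esub>
        pm_bilinear (\<lambda>(b, b') (v, w). (act V b v, act W b' w)) p r))"


section \<open>The quantum loop algebra\<close>

text \<open>
  The free monoid, written additively because \<^typ>\<open>'m \<Rightarrow>\<^sub>0 complex\<close> with \<open>'m::monoid_add\<close> is the
  library's monoid algebra; hence \<open>'g fmonoid \<Rightarrow>\<^sub>0 complex\<close> is the free algebra on \<open>'g\<close>.
\<close>

datatype 'g fmonoid = Fmonoid "'g list"

instantiation fmonoid :: (type) monoid_add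
begin

definition zero_fmonoid :: "'g fmonoid" where
  "zero_fmonoid = Fmonoid []"

fun plus_fmonoid :: "'g fmonoid \<Rightarrow> 'g fmonoid \<Rightarrow> 'g fmonoid" where
  "plus_fmonoid (Fmonoid xs) (Fmonoid ys) = Fmonoid (xs @ ys)"

instance
proof
  fix x y z :: "'g fmonoid"
  show "x + y + z = x + (y + z)" by (cases x; cases y; cases z) simp
  show "0 + x = x" "x + 0 = x" by (cases x; simp add: zero_fmonoid_def)+
qed

end

datatype 'k qgen = Egen 'k | Fgen 'k | Kgen 'k | Kinvgen 'k

type_synonym 'k qfree = "'k qgen fmonoid \<Rightarrow>\<^sub>0 complex"
type_synonym 'k qelem = "'k qfree set"

definition free_alg :: "(complex, 'g fmonoid \<Rightarrow>\<^sub>0 complex) module" where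
  "free_alg = \<lparr>carrier = UNIV, monoid.mult = (*), one = 1, zero = 0, add = (+), module.smult = pm_scale\<rparr>"

definition fgen :: "'g \<Rightarrow> 'g fmonoid \<Rightarrow>\<^sub>0 complex" where
  "fgen g = Poly_Mapping.single (Fmonoid [g]) 1"

definition qint :: "complex \<Rightarrow> nat \<Rightarrow> complex" where
  "qint x m = (x ^ m - inverse x ^ m) / (x - inverse x)"

definition qfact :: "complex \<Rightarrow> nat \<Rightarrow> complex" where
  "qfact x m = (\<Prod>r=1..m. qint x r)"

definition divided_power ::
    "complex \<Rightarrow> ('g fmonoid \<Rightarrow>\<^sub>0 complex) \<Rightarrow> nat \<Rightarrow> ('g fmonoid \<Rightarrow>\<^sub>0 complex)" where
  "divided_power x p r = pm_scale (1 / qfact x r) (p ^ r)"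

definition serre ::
    "('k \<Rightarrow> 'k \<Rightarrow> int) \<Rightarrow> ('k \<Rightarrow> nat) \<Rightarrow> complex \<Rightarrow> ('k \<Rightarrow> 'k qfree) \<Rightarrow> 'k \<Rightarrow> 'k \<Rightarrow> 'k qfree" where
  "serre C d q x i j = (\<Sum>r=0..nat (1 - C i j).
     (-1) ^ r * divided_power (q ^ d i) (x i) (nat (1 - C i j) - r) * x j
              * divided_power (q ^ d i) (x i) r)"

text \<open>
  Since the \<open>k\<^sub>i\<close> commute, the product \<open>k\<^sub>0^a\<^sub>0 \<cdots> k\<^sub>n^a\<^sub>n\<close> may be taken in any order; as
  \<open>'k\<close> carries no preferred enumeration, the relation is imposed for each of them.
\<close>

definition qrels ::
    "('k::finite \<Rightarrow> 'k \<Rightarrow> int) \<Rightarrow> ('k \<Rightarrow> nat) \<Rightarrow> ('k \<Rightarrow> nat) \<Rightarrow> complex \<Rightarrow> 'k qfree set" where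
  "qrels C d a q = (let
       e = (\<lambda>i. fgen (Egen i)); f = (\<lambda>i. fgen (Fgen i));
       k = (\<lambda>i. fgen (Kgen i)); k' = (\<lambda>i. fgen (Kinvgen i))
     in {k i * k j - k j * k i |i j. True} \<union>
        {k i * k' i - 1 |i. True} \<union> {k' i * k i - 1 |i. True} \<union>
        {prod_list (map (\<lambda>i. k i ^ a i) is) - 1 |is. distinct is \<and> set is = UNIV} \<union>
        {k i * e j * k' i - pm_scale ((q ^ d i) powi C i j) (e j) |i j. True} \<union>
        {k i * f j * k' i - pm_scale ((q ^ d i) powi (- C i j)) (f j) |i j. True} \<union>
        {e i * f j - f j * e i -
           (if i = j then pm_scale (1 / (q ^ d i - inverse (q ^ d i))) (k i - k' i) else 0) |i j. True} \<union>
        {serre C d q e i j |i j. i \<noteq> j} \<union> {serre C d q f i j |i j. i \<noteq> j})"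

definition Uq_ideal ::
    "('k::finite \<Rightarrow> 'k \<Rightarrow> int) \<Rightarrow> ('k \<Rightarrow> nat) \<Rightarrow> ('k \<Rightarrow> nat) \<Rightarrow> complex \<Rightarrow> 'k qfree set" where
  "Uq_ideal C d a q = Idl\<^bsub>free_alg\<^esub> (qrels C d a q)"

definition Uq ::
    "('k::finite \<Rightarrow> 'k \<Rightarrow> int) \<Rightarrow> ('k \<Rightarrow> nat) \<Rightarrow> ('k \<Rightarrow> nat) \<Rightarrow> complex \<Rightarrow> (complex, 'k qelem) module" where
  "Uq C d a q = quot_alg free_alg (Uq_ideal C d a q)"

definition Ugen ::
    "('k::finite \<Rightarrow> 'k \<Rightarrow> int) \<Rightarrow> ('k \<Rightarrow> nat) \<Rightarrow> ('k \<Rightarrow> nat) \<Rightarrow> complex \<Rightarrow> 'k qgen \<Rightarrow> 'k qelem" where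
  "Ugen C d a q g = Uq_ideal C d a q +>\<^bsub>free_alg\<^esub> fgen g"

definition Uqb ::
    "('k::finite \<Rightarrow> 'k \<Rightarrow> int) \<Rightarrow> ('k \<Rightarrow> nat) \<Rightarrow> ('k \<Rightarrow> nat) \<Rightarrow> complex \<Rightarrow> (complex, 'k qelem) module" where
  "Uqb C d a q = (Uq C d a q)\<lparr>carrier := generate_alg (Uq C d a q)
     (Ugen C d a q ` (range Egen \<union> range Kgen \<union> range Kinvgen))\<rparr>"

text \<open>
  An algebra morphism out of \<open>U\<^sub>q(\<gg>)\<close> is determined on the carrier by its values on \<open>e\<^sub>i\<close>, \<open>f\<^sub>i\<close>,
  \<open>k\<^sub>i\<close>; so the following two predicates pin down the coproduct and \<open>\<sigma>\<^sub>q\<close>.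
\<close>

definition is_coproduct ::
    "('k::finite \<Rightarrow> 'k \<Rightarrow> int) \<Rightarrow> ('k \<Rightarrow> nat) \<Rightarrow> ('k \<Rightarrow> nat) \<Rightarrow> complex
      \<Rightarrow> ('k qelem \<Rightarrow> ('k qelem \<times> 'k qelem \<Rightarrow>\<^sub>0 complex) set) \<Rightarrow> bool" where
  "is_coproduct C d a q \<Delta> \<longleftrightarrow> (let
       U = Uq C d a q; t = pure_tensor U U;
       e = (\<lambda>i. Ugen C d a q (Egen i)); f = (\<lambda>i. Ugen C d a q (Fgen i));
       k = (\<lambda>i. Ugen C d a q (Kgen i)); k' = (\<lambda>i. Ugen C d a q (Kinvgen i))
     in \<Delta> \<in> alg_hom U (tensor U U) \<and>
        (\<forall>i. \<Delta> (e i) = t (e i) \<one>\<^bsub>U\<^esub> \<oplus>\<^bsub>tensor U U\<^esub> t (k i) (e i) \<and>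
             \<Delta> (f i) = t (f i) (k' i) \<oplus>\<^bsub>tensor U U\<^esub> t \<one>\<^bsub>U\<^esub> (f i) \<and>
             \<Delta> (k i) = t (k i) (k i)))"

definition is_sigma ::
    "('k::finite \<Rightarrow> 'k \<Rightarrow> int) \<Rightarrow> ('k \<Rightarrow> nat) \<Rightarrow> ('k \<Rightarrow> nat) \<Rightarrow> complex \<Rightarrow> ('k qelem \<Rightarrow> 'k qelem) \<Rightarrow> bool" where
  "is_sigma C d a q \<sigma> \<longleftrightarrow> (let
       U = Uq C d a q; U' = Uq C d a (inverse q);
       x = Ugen C d a q; y = Ugen C d a (inverse q)
     in \<sigma> \<in> alg_iso U U' \<and>
        (\<forall>i. \<sigma> (x (Egen i)) = \<ominus>\<^bsub>U'\<^esub> (y (Kinvgen i) \<otimes>\<^bsub>U'\<^esub> y (Egen i)) \<and>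
             \<sigma> (x (Fgen i)) = \<ominus>\<^bsub>U'\<^esub> (y (Fgen i) \<otimes>\<^bsub>U'\<^esub> y (Kgen i)) \<and>
             \<sigma> (x (Kgen i)) = y (Kinvgen i)))"


section \<open>The category \<open>\<O>\<close>\<close>

text \<open>
  Here \<open>q = e^h\<close> and \<open>q^r = e^(h r)\<close>, so \<open>q\<inverse>\<close> corresponds to \<open>-h\<close>. Elements of \<open>P\<^sub>\<rat>\<close> are given by
  their coordinates with respect to the fundamental weights.
\<close>

definition torus :: "('i \<Rightarrow> complex) set" where
  "torus = {\<mu>. \<forall>i. \<mu> i \<noteq> 0}"

definition weight_bar :: "('i option \<Rightarrow> nat) \<Rightarrow> complex \<Rightarrow> ('i \<Rightarrow> rat) \<Rightarrow> 'i \<Rightarrow> complex" where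
  "weight_bar d h \<omega> = (\<lambda>j. exp (h * (of_nat (d (Some j)) * of_rat (\<omega> j))))"

text \<open>Uses \<open>\<alpha>\<^sub>i = \<Sum>\<^sub>j C\<^sub>j\<^sub>i \<omega>\<^sub>j\<close>.\<close>

definition Qplus :: "('i::finite option \<Rightarrow> 'i option \<Rightarrow> int) \<Rightarrow> ('i \<Rightarrow> rat) set" where
  "Qplus C = range (\<lambda>(m :: 'i \<Rightarrow> nat) j. \<Sum>i\<in>UNIV. of_nat (m i) * of_int (C (Some j) (Some i)))"

definition weight_le ::
    "('i::finite option \<Rightarrow> 'i option \<Rightarrow> int) \<Rightarrow> ('i option \<Rightarrow> nat) \<Rightarrow> complex
      \<Rightarrow> ('i \<Rightarrow> complex) \<Rightarrow> ('i \<Rightarrow> complex) \<Rightarrow> bool" where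
  "weight_le C d h \<mu> \<nu> \<longleftrightarrow> (\<lambda>i. \<nu> i * inverse (\<mu> i)) \<in> weight_bar d h ` Qplus C"

definition weight_space ::
    "('i::finite option \<Rightarrow> 'i option \<Rightarrow> int) \<Rightarrow> ('i option \<Rightarrow> nat) \<Rightarrow> ('i option \<Rightarrow> nat) \<Rightarrow> complex
      \<Rightarrow> ('i option qelem, 'v) amodule \<Rightarrow> ('i \<Rightarrow> complex) \<Rightarrow> 'v set" where
  "weight_space C d a q V \<mu> =
     {v \<in> carrier V. \<forall>i. act V (Ugen C d a q (Kgen (Some i))) v = \<mu> i \<odot>\<^bsub>V\<^esub> v}"

definition is_direct_sum ::
    "('u, 'v) amodule \<Rightarrow> 'j set \<Rightarrow> ('j \<Rightarrow> 'v set) \<Rightarrow> bool" where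
  "is_direct_sum V J S \<longleftrightarrow> (\<forall>v\<in>carrier V. \<exists>!f. f \<in> Pi\<^sub>E J S \<and>
     finite {j \<in> J. f j \<noteq> \<zero>\<^bsub>V\<^esub>} \<and> v = finsum V f {j \<in> J. f j \<noteq> \<zero>\<^bsub>V\<^esub>})"

definition finite_dim :: "('u, 'v) amodule \<Rightarrow> 'v set \<Rightarrow> bool" where
  "finite_dim V S \<longleftrightarrow> (\<exists>B. finite B \<and> B \<subseteq> S \<and>
     (\<forall>v\<in>S. \<exists>c :: 'v \<Rightarrow> complex. v = finsum V (\<lambda>b. c b \<odot>\<^bsub>V\<^esub> b) B))"

definition in_category_O ::
    "('i::finite option \<Rightarrow> 'i option \<Rightarrow> int) \<Rightarrow> ('i option \<Rightarrow> nat) \<Rightarrow> ('i option \<Rightarrow> nat) \<Rightarrow> complex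
      \<Rightarrow> ('i option qelem, 'v) amodule \<Rightarrow> bool" where
  "in_category_O C d a h V \<longleftrightarrow> (let S = weight_space C d a (exp h) V in
     alg_module (Uqb C d a (exp h)) V \<and>
     is_direct_sum V torus S \<and>
     (\<forall>\<mu>\<in>torus. finite_dim V (S \<mu>)) \<and>
     (\<exists>L. finite L \<and> L \<subseteq> torus \<and>
        (\<forall>\<mu>\<in>torus. S \<mu> \<noteq> {\<zero>\<^bsub>V\<^esub>} \<longrightarrow> (\<exists>\<nu>\<in>L. weight_le C d h \<mu> \<nu>))))"

text \<open>The tensor product of the category \<open>\<O>\<close>, for the coproduct \<open>\<Delta>\<close> of \<open>U\<^sub>q(\<gg>)\<close>.\<close>

definition O_tensor ::
    "('k::finite \<Rightarrow> 'k \<Rightarrow> int) \<Rightarrow> ('k \<Rightarrow> nat) \<Rightarrow> ('k \<Rightarrow> nat) \<Rightarrow> complex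
      \<Rightarrow> ('k qelem \<Rightarrow> ('k qelem \<times> 'k qelem \<Rightarrow>\<^sub>0 complex) set)
      \<Rightarrow> ('k qelem, 'v) amodule \<Rightarrow> ('k qelem, 'w) amodule
      \<Rightarrow> ('k qelem, ('v \<times> 'w \<Rightarrow>\<^sub>0 complex) set) amodule" where
  "O_tensor C d a q \<Delta> = tensor_amodule (restrict_coproduct (Uqb C d a q) \<Delta>)"


section \<open>The flip on pure tensors\<close>

lemma module_pm_scale: "Modules.module (pm_scale :: complex \<Rightarrow> ('a \<Rightarrow>\<^sub>0 complex) \<Rightarrow> _)"
proof
  fix c e :: complex and p r :: "'a \<Rightarrow>\<^sub>0 complex"
  have [simp]: "Poly_Mapping.lookup (pm_scale u s) k = u * Poly_Mapping.lookup s k"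
    for u and s :: "'a \<Rightarrow>\<^sub>0 complex" and k
    by (simp add: Poly_Mapping.map.rep_eq when_def)
  show "pm_scale c (p + r) = pm_scale c p + pm_scale c r"
    by (rule poly_mapping_eqI) (simp add: lookup_add algebra_simps)
  show "pm_scale (c + e) p = pm_scale c p + pm_scale e p"
    by (rule poly_mapping_eqI) (simp add: lookup_add algebra_simps)
  show "pm_scale c (pm_scale e p) = pm_scale (c * e) p"
    by (rule poly_mapping_eqI) (simp add: algebra_simps)
  show "pm_scale 1 p = p"
    by (rule poly_mapping_eqI) simp
qed

lemma map_key_minus:
  assumes "inj f"
  shows "Poly_Mapping.map_key f (p - r) = Poly_Mapping.map_key f p - Poly_Mapping.map_key f (r :: 'a \<Rightarrow>\<^sub>0 complex)"
  by (rule poly_mapping_eqI) (simp add: lookup_minus map_key.rep_eq[OF assms])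

lemma map_key_swap_single:
  "Poly_Mapping.map_key prod.swap (Poly_Mapping.single (x, y) c) = Poly_Mapping.single (y, x) c"
  using map_key_single[of prod.swap "(y, x)" c] by simp

lemma swap_bilinear_rels:
  "Poly_Mapping.map_key prod.swap ` bilinear_rels A B \<subseteq> bilinear_rels B A"
proof (rule image_subsetI)
  fix p assume "p \<in> bilinear_rels A B"
  then show "Poly_Mapping.map_key prod.swap p \<in> bilinear_rels B A"
    unfolding bilinear_rels_def Let_def
  proof (elim UnE CollectE exE conjE, goal_cases)
    case (1 u u' v)
    show ?case
      by (rule UnI1, rule UnI1, rule UnI2, rule CollectI, rule exI[of _ v], rule exI[of _ u], rule exI[of _ u'])
         (use 1 in \<open>simp add: map_key_minus map_key_swap_single\<close>)
  next
    case (2 u v v')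
    show ?case
      by (rule UnI1, rule UnI1, rule UnI1, rule CollectI, rule exI[of _ v], rule exI[of _ v'], rule exI[of _ u])
         (use 2 in \<open>simp add: map_key_minus map_key_swap_single\<close>)
  next
    case (3 c u v)
    show ?case
      by (rule UnI2, rule CollectI, rule exI[of _ c], rule exI[of _ v], rule exI[of _ u])
         (use 3 in \<open>simp add: map_key_minus map_key_map map_key_swap_single\<close>)
  next
    case (4 c u v)
    show ?case
      by (rule UnI1, rule UnI2, rule CollectI, rule exI[of _ c], rule exI[of _ v], rule exI[of _ u])
         (use 4 in \<open>simp add: map_key_minus map_key_map map_key_swap_single\<close>)
  qed
qed

lemma map_key_swap_swap:
  "Poly_Mapping.map_key prod.swap (Poly_Mapping.map_key prod.swap p) = p"
  by (rule poly_mapping_eqI) (simp add: map_key.rep_eq)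

lemma swap_bilinear_rels_eq:
  "Poly_Mapping.map_key prod.swap ` bilinear_rels A B = bilinear_rels B A"
proof
  show "bilinear_rels B A \<subseteq> Poly_Mapping.map_key prod.swap ` bilinear_rels A B"
  proof
    fix p assume "p \<in> bilinear_rels B A"
    then have "Poly_Mapping.map_key prod.swap p \<in> bilinear_rels A B"
      using swap_bilinear_rels by blast
    then show "p \<in> Poly_Mapping.map_key prod.swap ` bilinear_rels A B"
      by (metis image_eqI map_key_swap_swap)
  qed
qed (rule swap_bilinear_rels)

lemma swap_tensor_null:
  fixes A :: "(complex, 'a, 'x) module_scheme" and B :: "(complex, 'b, 'y) module_scheme"
  shows "Poly_Mapping.map_key prod.swap ` tensor_null A B = tensor_null B A"
proof -
  interpret module_hom pm_scale pm_scale "Poly_Mapping.map_key prod.swap ::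
      ('a \<times> 'b \<Rightarrow>\<^sub>0 complex) \<Rightarrow> ('b \<times> 'a \<Rightarrow>\<^sub>0 complex)"
    by (intro module_hom.intro module_pm_scale module_hom_axioms.intro)
       (simp_all add: map_key_plus map_key_map)
  show ?thesis
    unfolding tensor_null_def swap_bilinear_rels_eq[of A B, symmetric] by (rule span_image[symmetric])
qed

lemma flip_pure_tensor: "flip (pure_tensor A B x y) = pure_tensor B A y x"
proof -
  have *: "pure_tensor A B x y = (\<lambda>p. p + Poly_Mapping.single (x, y) 1) ` tensor_null A B" for A B x y
    unfolding pure_tensor_def a_r_coset_def' free_tensor_def by auto
  show ?thesis
    unfolding flip_def * swap_tensor_null[of A B, symmetric] image_image
    by (simp only: map_key_plus[OF inj_swap] map_key_swap_single)
qed

end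

theory Submission
  imports Defs
begin

text \<open>
  The flip identifies the vector spaces \<open>V \<otimes> W\<close> and \<open>W \<otimes> V\<close>, so the only question is whether it commutes
  with the actions. An element \<open>x\<close> of the Borel subalgebra \<open>B\<close> acts on \<open>F V \<otimes> F W\<close> through
  \<open>(\<sigma> \<otimes> \<sigma>) (\<Delta> x)\<close> and on \<open>F (W \<otimes> V)\<close> through \<open>\<Delta>' (\<sigma> x)\<close>, and the flip exchanges the two as soon as
  \<open>\<Delta>' \<circ> \<sigma> = flip \<circ> (\<sigma> \<otimes> \<sigma>) \<circ> \<Delta>\<close>. Both sides of this identity are algebra morphisms, so it suffices to
  compare them on the generators. On \<open>k\<^sub>i\<close> this is clear, and on \<open>e\<^sub>i\<close> both sides are
  \<open>- k\<^sub>i\<inverse> e\<^sub>i \<otimes> k\<^sub>i\<inverse> - 1 \<otimes> k\<^sub>i\<inverse> e\<^sub>i\<close>; here \<open>\<Delta>' (k\<^sub>i\<inverse>) = k\<^sub>i\<inverse> \<otimes> k\<^sub>i\<inverse>\<close> because \<open>\<Delta>'\<close> is multiplicative. See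
  \<open>coproduct_\<sigma>\<close> and \<open>flip_act\<close>.

  The rest of the work is to see that the tensor products are modules at all. Tensors are cosets of
  finitely supported functions, and the maps between tensor products that occur are controlled by one fact: if
  \<open>f\<close> and \<open>g\<close> are linear, then \<open>f \<otimes> g\<close> respects the bilinearity relations (\<open>pm_push_tensor_null\<close>). The
  subtle point is that \<open>\<Delta> x\<close> is given as an element of \<open>U \<otimes> U\<close>, with \<open>U\<close> the whole quantum loop algebra,
  whereas only \<open>B\<close> acts on the modules: two representatives of \<open>\<Delta> x\<close> supported on \<open>B \<times> B\<close> are known to
  be equal in \<open>U \<otimes> U\<close>, but they have to be equal in \<open>B \<otimes> B\<close>. As \<open>B\<close> is a linear direct summand of \<open>U\<close>, a
  linear projection \<open>\<pi>\<close> of \<open>U\<close> onto \<open>B\<close> exists, and \<open>\<pi> \<otimes> \<pi>\<close> carries the relations of \<open>U \<otimes> U\<close> to relations of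
  \<open>B \<otimes> B\<close> (\<open>tensor_null_B\<close>).
\<close>

section \<open>Linear extension in free vector spaces\<close>

interpretation pm: vector_space "pm_scale :: complex \<Rightarrow> ('a \<Rightarrow>\<^sub>0 complex) \<Rightarrow> ('a \<Rightarrow>\<^sub>0 complex)"
  using module_pm_scale by (simp add: vector_space_def Modules.module_def)

lemma lookup_pm_scale [simp]: "Poly_Mapping.lookup (pm_scale c p) x = c * Poly_Mapping.lookup p x"
  by (simp add: Poly_Mapping.map.rep_eq when_def)

text \<open>
  The linear map on the free vector space that extends \<open>\<phi>\<close> from the basis.
\<close>

definition lin_ext :: "('a \<Rightarrow> ('b \<Rightarrow>\<^sub>0 complex)) \<Rightarrow> ('a \<Rightarrow>\<^sub>0 complex) \<Rightarrow> ('b \<Rightarrow>\<^sub>0 complex)" where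
  "lin_ext \<phi> p = (\<Sum>x\<in>Poly_Mapping.keys p. pm_scale (Poly_Mapping.lookup p x) (\<phi> x))"

abbreviation pm_push :: "('a \<Rightarrow> 'b) \<Rightarrow> ('a \<Rightarrow>\<^sub>0 complex) \<Rightarrow> ('b \<Rightarrow>\<^sub>0 complex)" where
  "pm_push F \<equiv> lin_ext (\<lambda>x. Poly_Mapping.single (F x) 1)"

lemma lin_ext_superset:
  assumes "finite S" "Poly_Mapping.keys p \<subseteq> S"
  shows "lin_ext \<phi> p = (\<Sum>x\<in>S. pm_scale (Poly_Mapping.lookup p x) (\<phi> x))"
  unfolding lin_ext_def using assms
  by (intro sum.mono_neutral_left) (auto simp: in_keys_iff)

lemma keys_pm_scale: "Poly_Mapping.keys (pm_scale c p) \<subseteq> Poly_Mapping.keys p"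
  by (auto simp: in_keys_iff)

lemma lin_ext_add: "lin_ext \<phi> (p + r) = lin_ext \<phi> p + lin_ext \<phi> r"
proof -
  have fin: "finite (Poly_Mapping.keys p \<union> Poly_Mapping.keys r)" by simp
  show ?thesis
    using lin_ext_superset[OF fin, of p \<phi>] lin_ext_superset[OF fin, of r \<phi>]
      lin_ext_superset[OF fin, of "p + r" \<phi>] keys_add[of p r]
    by (simp add: lookup_add pm.scale_left_distrib sum.distrib)
qed

lemma lin_ext_scale: "lin_ext \<phi> (pm_scale c p) = pm_scale c (lin_ext \<phi> p)"
  using lin_ext_superset[OF finite_keys keys_pm_scale, of \<phi> c p]
  by (simp add: lin_ext_def pm.scale_sum_right)

lemma linear_lin_ext: "Vector_Spaces.linear pm_scale pm_scale (lin_ext \<phi>)"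
  by (rule Vector_Spaces.linear.intro)
     (simp_all add: pm.vector_space_axioms module_hom_def module_hom_axioms_def
        pm.module_axioms lin_ext_add lin_ext_scale)

interpretation lin_ext: Vector_Spaces.linear pm_scale pm_scale "lin_ext \<phi>" for \<phi>
  by (rule linear_lin_ext)

lemma lin_ext_single [simp]: "lin_ext \<phi> (Poly_Mapping.single x c) = pm_scale c (\<phi> x)"
  by (simp add: lin_ext_def)

lemma pm_scale_single [simp]:
  "pm_scale c (Poly_Mapping.single x e) = Poly_Mapping.single x (c * e)"
  by (simp add: Poly_Mapping.map_single)

lemma lin_ext_cong:
  "p = r \<Longrightarrow> (\<And>x. x \<in> Poly_Mapping.keys r \<Longrightarrow> \<phi> x = \<psi> x) \<Longrightarrow> lin_ext \<phi> p = lin_ext \<psi> r"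
  by (simp add: lin_ext_def)

text \<open>
  The basis of the delta functions spans, so every linear map is the extension of its values there.
  This turns identities between linear maps into checks on single basis elements.
\<close>

lemma linear_eq_lin_ext:
  assumes "Vector_Spaces.linear pm_scale pm_scale G"
  shows "G p = lin_ext (\<lambda>x. G (Poly_Mapping.single x 1)) p"
proof -
  interpret G: Vector_Spaces.linear pm_scale pm_scale G by fact
  have "p = (\<Sum>x\<in>Poly_Mapping.keys p. pm_scale (Poly_Mapping.lookup p x) (Poly_Mapping.single x 1))"
    by (rule poly_mapping_eqI)
       (simp add: lookup_sum lookup_single when_def sum.delta in_keys_iff)
  then have "G p = G (\<Sum>x\<in>Poly_Mapping.keys p. pm_scale (Poly_Mapping.lookup p x) (Poly_Mapping.single x 1))"
    by simp
  then show ?thesis by (simp only: G.sum G.scale lin_ext_def)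
qed

lemma lin_ext_comp: "lin_ext \<phi> (lin_ext \<psi> p) = lin_ext (\<lambda>x. lin_ext \<phi> (\<psi> x)) p"
proof -
  have "lin_ext \<phi> (lin_ext \<psi> p) = lin_ext \<phi> (\<Sum>x\<in>Poly_Mapping.keys p. pm_scale (Poly_Mapping.lookup p x) (\<psi> x))"
    by (simp only: lin_ext_def[of \<psi>])
  also have "\<dots> = (\<Sum>x\<in>Poly_Mapping.keys p. pm_scale (Poly_Mapping.lookup p x) (lin_ext \<phi> (\<psi> x)))"
    by (simp only: lin_ext.sum lin_ext.scale)
  also have "\<dots> = lin_ext (\<lambda>x. lin_ext \<phi> (\<psi> x)) p"
    by (simp only: lin_ext_def[of "\<lambda>x. lin_ext \<phi> (\<psi> x)"])
  finally show ?thesis .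
qed

lemma pm_push_id: "(\<And>x. x \<in> Poly_Mapping.keys p \<Longrightarrow> F x = x) \<Longrightarrow> pm_push F p = p"
  using linear_eq_lin_ext[OF pm.linear_id, of p] lin_ext_cong[OF refl, of p "\<lambda>x. Poly_Mapping.single (F x) 1" "\<lambda>x. Poly_Mapping.single x 1"]
  by simp

lemma lin_ext_subspace:
  assumes "pm.subspace N" "\<And>x. x \<in> Poly_Mapping.keys p \<Longrightarrow> \<phi> x \<in> N"
  shows "lin_ext \<phi> p \<in> N"
  unfolding lin_ext_def using assms by (intro pm.subspace_sum pm.subspace_scale)

text \<open>
  Bilinear extension is iterated linear extension. All the identities for bilinear products below
  (associativity, compatibility with pushforward) reduce in this way to the composition rule
  for linear extensions.
\<close>

lemma pm_bilinear_eq_lin_ext: "pm_bilinear f p r = lin_ext (\<lambda>x. pm_push (f x) r) p"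
  by (simp add: pm_bilinear_def lin_ext_def pm.scale_sum_right)

lemma subspace_supported: "pm.subspace {p. Poly_Mapping.keys p \<subseteq> S}"
  by (rule pm.subspaceI) (auto dest!: subsetD[OF keys_add] subsetD[OF keys_pm_scale])

lemma keys_pm_push: "Poly_Mapping.keys (pm_push F p) \<subseteq> F ` Poly_Mapping.keys p"
proof -
  have "pm_push F p \<in> {r. Poly_Mapping.keys r \<subseteq> F ` Poly_Mapping.keys p}"
    by (rule lin_ext_subspace[OF subspace_supported]) simp
  then show ?thesis by simp
qed

lemma keys_pm_bilinear:
  assumes "\<And>x y. x \<in> Poly_Mapping.keys p \<Longrightarrow> y \<in> Poly_Mapping.keys r \<Longrightarrow> f x y \<in> S"
  shows "Poly_Mapping.keys (pm_bilinear f p r) \<subseteq> S"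
proof -
  have "pm_bilinear f p r \<in> {r. Poly_Mapping.keys r \<subseteq> S}"
    unfolding pm_bilinear_eq_lin_ext
  proof (rule lin_ext_subspace[OF subspace_supported])
    fix x assume "x \<in> Poly_Mapping.keys p"
    then have "f x ` Poly_Mapping.keys r \<subseteq> S" using assms by auto
    then show "pm_push (f x) r \<in> {r. Poly_Mapping.keys r \<subseteq> S}" using keys_pm_push[of "f x" r] by auto
  qed
  then show ?thesis by simp
qed

lemma pm_bilinear_add_left: "pm_bilinear f (p + p') r = pm_bilinear f p r + pm_bilinear f p' r"
  and pm_bilinear_scale_left: "pm_bilinear f (pm_scale c p) r = pm_scale c (pm_bilinear f p r)"
  and pm_bilinear_diff_left: "pm_bilinear f (p - p') r = pm_bilinear f p r - pm_bilinear f p' r"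
  by (simp_all add: pm_bilinear_eq_lin_ext lin_ext.add lin_ext.scale lin_ext.diff)

lemma pm_bilinear_add_right: "pm_bilinear f p (r + r') = pm_bilinear f p r + pm_bilinear f p r'"
  and pm_bilinear_scale_right: "pm_bilinear f p (pm_scale c r) = pm_scale c (pm_bilinear f p r)"
  and pm_bilinear_diff_right: "pm_bilinear f p (r - r') = pm_bilinear f p r - pm_bilinear f p r'"
  by (simp_all add: pm_bilinear_eq_lin_ext lin_ext_def[of _ p] lin_ext.add lin_ext.scale lin_ext.diff
        pm.scale_right_distrib pm.scale_right_diff_distrib sum.distrib sum_subtractf
        pm.scale_sum_right mult.commute)

lemma pm_bilinear_assoc:
  assumes "\<And>x y z. x \<in> Poly_Mapping.keys p \<Longrightarrow> y \<in> Poly_Mapping.keys p' \<Longrightarrow> z \<in> Poly_Mapping.keys r \<Longrightarrow>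
    g (m x y) z = g' x (g'' y z)"
  shows "pm_bilinear g (pm_bilinear m p p') r = pm_bilinear g' p (pm_bilinear g'' p' r)"
  unfolding pm_bilinear_eq_lin_ext lin_ext_comp lin_ext_single pm.scale_one
  by (intro lin_ext_cong refl) (simp add: assms)

lemma pm_push_pm_bilinear:
  assumes "\<And>x y. x \<in> Poly_Mapping.keys p \<Longrightarrow> y \<in> Poly_Mapping.keys r \<Longrightarrow> F (m x y) = m' (G x) (H y)"
  shows "pm_push F (pm_bilinear m p r) = pm_bilinear m' (pm_push G p) (pm_push H r)"
  unfolding pm_bilinear_eq_lin_ext lin_ext_comp lin_ext_single pm.scale_one
  by (intro lin_ext_cong refl) (simp add: assms)

section \<open>Quotients of free vector spaces\<close>

text \<open>
  Membership in a coset is expressed by a difference, so that equality of cosets and computations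
  with representatives become statements about the subspace alone.
\<close>

definition pm_coset :: "('a \<Rightarrow>\<^sub>0 complex) set \<Rightarrow> ('a \<Rightarrow>\<^sub>0 complex) \<Rightarrow> ('a \<Rightarrow>\<^sub>0 complex) set" where
  "pm_coset N p = {r. r - p \<in> N}"

lemma a_r_coset_eq_pm_coset:
  assumes "ring.add F = (+)"
  shows "N +>\<^bsub>F\<^esub> p = pm_coset N p"
  by (auto simp: a_r_coset_def' assms pm_coset_def )

lemma pm_coset_eq_iff:
  assumes "pm.subspace N"
  shows "pm_coset N p = pm_coset N r \<longleftrightarrow> p - r \<in> N"
proof
  assume eq: "pm_coset N p = pm_coset N r"
  have "p \<in> pm_coset N p" using pm.subspace_0[OF assms] by (simp add: pm_coset_def)
  then have "p \<in> pm_coset N r" unfolding eq .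
  then show "p - r \<in> N" by (simp add: pm_coset_def)
next
  assume *: "p - r \<in> N"
  have "s - p \<in> N \<longleftrightarrow> s - r \<in> N" for s
  proof
    assume "s - p \<in> N"
    then have "(s - p) + (p - r) \<in> N" using * by (rule pm.subspace_add[OF assms])
    then show "s - r \<in> N" by simp
  next
    assume "s - r \<in> N"
    then have "(s - r) - (p - r) \<in> N" using * by (rule pm.subspace_diff[OF assms])
    then show "s - p \<in> N" by simp
  qed
  then show "pm_coset N p = pm_coset N r" by (simp add: pm_coset_def)
qed

lemma pm_coset_self: "pm.subspace N \<Longrightarrow> p \<in> pm_coset N p"
  by (simp add: pm_coset_def pm.subspace_0)

lemma pm_coset_eqI: "pm.subspace N \<Longrightarrow> r \<in> pm_coset N p \<Longrightarrow> pm_coset N p = pm_coset N r"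
  using pm_coset_eq_iff[of N r p] by (simp add: pm_coset_def)

text \<open>
  The common frame of the two quotients that occur: the free algebra modulo the defining relations and
  the free space on pairs modulo the bilinearity relations.
\<close>

locale pm_quotient =
  fixes F :: "(complex, 'a \<Rightarrow>\<^sub>0 complex, 'x) module_scheme" and N :: "('a \<Rightarrow>\<^sub>0 complex) set"
  assumes add_F: "ring.add F = (+)" and smult_F: "module.smult F = pm_scale"
    and subspace_F: "pm.subspace (carrier F)" and subspace_N: "pm.subspace N" and N_subset: "N \<subseteq> carrier F"
begin

lemma carrier_quot: "carrier (quot_alg F N) = pm_coset N ` carrier F"
  by (auto simp: quot_alg_def ring.defs module.defs FactRing_def A_RCOSETS_def'
        a_r_coset_eq_pm_coset[OF add_F])

text \<open>
  The algebra morphisms into a quotient below are only known through elements of their values. For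
  them the useful form of the quotient operations is that operating on representatives yields a
  representative of the result.
\<close>

lemma add_mem_quot:
  assumes "p \<in> S" "r \<in> Y"
  shows "p + r \<in> S \<oplus>\<^bsub>quot_alg F N\<^esub> Y"
  using assms
  by (auto simp: quot_alg_def ring.defs module.defs FactRing_def set_add_def' add_F)

lemma smult_mem_quot:
  "p \<in> S \<Longrightarrow> pm_scale c p \<in> c \<odot>\<^bsub>quot_alg F N\<^esub> S"
  by (auto simp: quot_alg_def ring.defs module.defs FactRing_def
        a_r_coset_eq_pm_coset[OF add_F] smult_F intro!: bexI[of _ p] pm_coset_self[OF subspace_N])

lemma mult_mem_quot:
  "p \<in> S \<Longrightarrow> r \<in> Y \<Longrightarrow> p \<otimes>\<^bsub>F\<^esub> r \<in> S \<otimes>\<^bsub>quot_alg F N\<^esub> Y"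
  using pm_coset_self[OF subspace_N]
  by (auto simp: quot_alg_def ring.defs module.defs FactRing_def rcoset_mult_def
        a_r_coset_eq_pm_coset[OF add_F])

lemma one_quot: "\<one>\<^bsub>quot_alg F N\<^esub> = pm_coset N \<one>\<^bsub>F\<^esub>"
  by (simp add: quot_alg_def ring.defs module.defs FactRing_def a_r_coset_eq_pm_coset[OF add_F])

lemma zero_quot: "\<zero>\<^bsub>quot_alg F N\<^esub> = pm_coset N 0"
  by (simp add: quot_alg_def ring.defs module.defs FactRing_def pm_coset_def)

lemma add_quot: "pm_coset N p \<oplus>\<^bsub>quot_alg F N\<^esub> pm_coset N r = pm_coset N (p + r)"
proof (intro equalityI subsetI)
  fix s assume "s \<in> pm_coset N p \<oplus>\<^bsub>quot_alg F N\<^esub> pm_coset N r"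
  then obtain u v where "s = u + v" "u - p \<in> N" "v - r \<in> N"
    by (auto simp: quot_alg_def ring.defs module.defs FactRing_def set_add_def' add_F pm_coset_def)
  then show "s \<in> pm_coset N (p + r)"
    using pm.subspace_add[OF subspace_N, of "u - p" "v - r"] by (simp add: pm_coset_def algebra_simps)
next
  fix s assume "s \<in> pm_coset N (p + r)"
  then have "s - r \<in> pm_coset N p" by (simp add: pm_coset_def algebra_simps)
  from add_mem_quot[OF this pm_coset_self[OF subspace_N, of r]]
  show "s \<in> pm_coset N p \<oplus>\<^bsub>quot_alg F N\<^esub> pm_coset N r" by simp
qed

lemma smult_quot: "c \<odot>\<^bsub>quot_alg F N\<^esub> pm_coset N p = pm_coset N (pm_scale c p)"
proof -
  have *: "pm_coset N (pm_scale c r) = pm_coset N (pm_scale c p)" if "r \<in> pm_coset N p" for r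
  proof -
    have "r - p \<in> N" using that by (simp add: pm_coset_def)
    then have "pm_scale c (r - p) \<in> N" by (rule pm.subspace_scale[OF subspace_N])
    then show ?thesis unfolding pm_coset_eq_iff[OF subspace_N] pm.scale_right_diff_distrib .
  qed
  have "c \<odot>\<^bsub>quot_alg F N\<^esub> pm_coset N p = (\<Union>r\<in>pm_coset N p. pm_coset N (pm_scale c r))"
    by (simp add: quot_alg_def ring.defs module.defs a_r_coset_eq_pm_coset[OF add_F] smult_F)
  also have "\<dots> = (\<Union>r\<in>pm_coset N p. pm_coset N (pm_scale c p))"
    by (rule SUP_cong[OF refl *])
  also have "\<dots> = pm_coset N (pm_scale c p)"
    using pm_coset_self[OF subspace_N, of p] by (simp add: ex_in_conv[symmetric]) blast
  finally show ?thesis .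
qed

lemma module_quot: "Module.module complex_ring (quot_alg F N)"
proof -
  note ops = carrier_quot add_quot smult_quot zero_quot
  show ?thesis
  proof (rule moduleI)
    show "cring complex_ring" by (rule cring_from_type_algebra)
  next
    show "abelian_group (quot_alg F N)"
    proof (rule abelian_groupI, goal_cases)
      case (4 S T)
      then show ?case by (auto simp: ops) (simp_all add: add.commute)
    next
      case (6 S)
      then obtain p where "p \<in> carrier F" "S = pm_coset N p" by (auto simp: ops)
      then show ?case
        using pm.subspace_neg[OF subspace_F] by (intro bexI[of _ "pm_coset N (- p)"]) (auto simp: ops)
    qed (use pm.subspace_add[OF subspace_F] pm.subspace_0[OF subspace_F] in
          \<open>auto simp: ops add.assoc\<close>)
  qed (use pm.subspace_scale[OF subspace_F] in
        \<open>auto simp: ops ring_of_type_algebra_def pm.scale_left_distrib pm.scale_right_distrib\<close>)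
qed

lemma coset_of_mem:
  assumes "S \<in> carrier (quot_alg F N)" "p \<in> S"
  shows "S = pm_coset N p" "p \<in> carrier F"
proof -
  obtain r where r: "r \<in> carrier F" "S = pm_coset N r" using assms by (auto simp: carrier_quot)
  then show "S = pm_coset N p" using assms pm_coset_eqI[OF subspace_N] by blast
  have "p - r \<in> carrier F" using assms r N_subset by (auto simp: pm_coset_def)
  then show "p \<in> carrier F" using pm.subspace_add[OF subspace_F _ r(1), of "p - r"] by simp
qed

lemma quot_nonempty: "S \<in> carrier (quot_alg F N) \<Longrightarrow> \<exists>p. p \<in> S"
  using pm_coset_self[OF subspace_N] by (auto simp: carrier_quot)

end

section \<open>Functoriality of the tensor product\<close>

lemma carrier_free_tensor: "carrier (free_tensor A B) = {p. Poly_Mapping.keys p \<subseteq> carrier A \<times> carrier B}"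
  by (simp add: free_tensor_def)

lemma subspace_tensor_null: "pm.subspace (tensor_null A B)"
  by (simp add: tensor_null_def pm.subspace_span)

lemma tensor_null_add_left:
  assumes "u \<in> carrier A" "u' \<in> carrier A" "v \<in> carrier B"
  shows "Poly_Mapping.single (u \<oplus>\<^bsub>A\<^esub> u', v) 1 - Poly_Mapping.single (u, v) 1 - Poly_Mapping.single (u', v) 1
    \<in> tensor_null A B"
  unfolding tensor_null_def bilinear_rels_def Let_def by (rule pm.span_base) (use assms in blast)

lemma tensor_null_add_right:
  assumes "u \<in> carrier A" "v \<in> carrier B" "v' \<in> carrier B"
  shows "Poly_Mapping.single (u, v \<oplus>\<^bsub>B\<^esub> v') 1 - Poly_Mapping.single (u, v) 1 - Poly_Mapping.single (u, v') 1
    \<in> tensor_null A B"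
  unfolding tensor_null_def bilinear_rels_def Let_def by (rule pm.span_base) (use assms in blast)

lemma tensor_null_smult_left:
  assumes "u \<in> carrier A" "v \<in> carrier B"
  shows "Poly_Mapping.single (c \<odot>\<^bsub>A\<^esub> u, v) 1 - pm_scale c (Poly_Mapping.single (u, v) 1) \<in> tensor_null A B"
  unfolding tensor_null_def bilinear_rels_def Let_def by (rule pm.span_base) (use assms in blast)

lemma tensor_null_smult_right:
  assumes "u \<in> carrier A" "v \<in> carrier B"
  shows "Poly_Mapping.single (u, c \<odot>\<^bsub>B\<^esub> v) 1 - pm_scale c (Poly_Mapping.single (u, v) 1) \<in> tensor_null A B"
  unfolding tensor_null_def bilinear_rels_def Let_def by (rule pm.span_base) (use assms in blast)

lemma tensor_null_minimal:
  assumes "pm.subspace N"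
    and "\<And>u u' v. u \<in> carrier A \<Longrightarrow> u' \<in> carrier A \<Longrightarrow> v \<in> carrier B \<Longrightarrow>
      Poly_Mapping.single (u \<oplus>\<^bsub>A\<^esub> u', v) 1 - Poly_Mapping.single (u, v) 1 - Poly_Mapping.single (u', v) 1 \<in> N"
    and "\<And>u v v'. u \<in> carrier A \<Longrightarrow> v \<in> carrier B \<Longrightarrow> v' \<in> carrier B \<Longrightarrow>
      Poly_Mapping.single (u, v \<oplus>\<^bsub>B\<^esub> v') 1 - Poly_Mapping.single (u, v) 1 - Poly_Mapping.single (u, v') 1 \<in> N"
    and "\<And>c u v. u \<in> carrier A \<Longrightarrow> v \<in> carrier B \<Longrightarrow>
      Poly_Mapping.single (c \<odot>\<^bsub>A\<^esub> u, v) 1 - pm_scale c (Poly_Mapping.single (u, v) 1) \<in> N"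
    and "\<And>c u v. u \<in> carrier A \<Longrightarrow> v \<in> carrier B \<Longrightarrow>
      Poly_Mapping.single (u, c \<odot>\<^bsub>B\<^esub> v) 1 - pm_scale c (Poly_Mapping.single (u, v) 1) \<in> N"
  shows "tensor_null A B \<subseteq> N"
  unfolding tensor_null_def bilinear_rels_def Let_def
  by (rule pm.span_minimal[OF _ assms(1)]) (use assms(2-) in blast)

definition lin_maps ::
    "(complex, 'a, 'x) module_scheme \<Rightarrow> (complex, 'b, 'y) module_scheme \<Rightarrow> ('a \<Rightarrow> 'b) set" where
  "lin_maps A B = {f \<in> carrier A \<rightarrow> carrier B.
     (\<forall>u\<in>carrier A. \<forall>v\<in>carrier A. f (u \<oplus>\<^bsub>A\<^esub> v) = f u \<oplus>\<^bsub>B\<^esub> f v) \<and>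
     (\<forall>c. \<forall>u\<in>carrier A. f (c \<odot>\<^bsub>A\<^esub> u) = c \<odot>\<^bsub>B\<^esub> f u)}"

text \<open>
  The map \<open>f \<otimes> g\<close> is well defined: on pairs, it sends each bilinearity relation to a
  relation of the same kind.
\<close>

lemma pm_push_tensor_null:
  assumes f: "f \<in> lin_maps A A'" and g: "g \<in> lin_maps B B'" and p: "p \<in> tensor_null A B"
  shows "pm_push (map_prod f g) p \<in> tensor_null A' B'"
proof -
  have clf: "f u \<in> carrier A'" "f (u \<oplus>\<^bsub>A\<^esub> v) = f u \<oplus>\<^bsub>A'\<^esub> f v" "f (c \<odot>\<^bsub>A\<^esub> u) = c \<odot>\<^bsub>A'\<^esub> f u"
    if "u \<in> carrier A" "v \<in> carrier A" for u v c using f that by (auto simp: lin_maps_def)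
  have clg: "g u \<in> carrier B'" "g (u \<oplus>\<^bsub>B\<^esub> v) = g u \<oplus>\<^bsub>B'\<^esub> g v" "g (c \<odot>\<^bsub>B\<^esub> u) = c \<odot>\<^bsub>B'\<^esub> g u"
    if "u \<in> carrier B" "v \<in> carrier B" for u v c using g that by (auto simp: lin_maps_def)
  have "tensor_null A B \<subseteq> {p. pm_push (map_prod f g) p \<in> tensor_null A' B'}"
  proof (rule tensor_null_minimal)
    show "pm.subspace {p. pm_push (map_prod f g) p \<in> tensor_null A' B'}"
      using lin_ext.subspace_vimage[OF subspace_tensor_null] by (simp add: vimage_def)
  qed (use tensor_null_add_left[of _ A' _ _ B'] tensor_null_add_right[of _ A' _ B']
        tensor_null_smult_left[of _ A' _ B'] tensor_null_smult_right[of _ A' _ B'] in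
       \<open>simp_all add: lin_ext.diff clf clg\<close>)
  then show ?thesis using p by blast
qed

text \<open>
  A bilinear operation is linear in either argument once the other is fixed to a basis element, and
  then it is of the form \<open>f \<otimes> g\<close>. Hence the action of \<open>B \<otimes> B\<close> on \<open>V \<otimes> W\<close> depends on classes only, in both
  arguments.
\<close>

lemma pm_bilinear_tensor_null_left:
  assumes "\<And>v w. (v, w) \<in> Poly_Mapping.keys r \<Longrightarrow>
      (\<lambda>b. f b v) \<in> lin_maps A A' \<and> (\<lambda>b. g b w) \<in> lin_maps B B'"
    and "p \<in> tensor_null A B"
  shows "pm_bilinear (\<lambda>(b, b') (v, w). (f b v, g b' w)) p r \<in> tensor_null A' B'"
proof -
  have "pm_bilinear (\<lambda>(b, b') (v, w). (f b v, g b' w)) p r =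
      lin_ext (\<lambda>(v, w). pm_push (map_prod (\<lambda>b. f b v) (\<lambda>b'. g b' w)) p) r"
    by (simp add: pm_bilinear_def lin_ext_def pm.scale_sum_right case_prod_unfold map_prod_def
          sum.swap[of _ "Poly_Mapping.keys r"] mult.commute)
  moreover have "lin_ext (\<lambda>(v, w). pm_push (map_prod (\<lambda>b. f b v) (\<lambda>b'. g b' w)) p) r \<in> tensor_null A' B'"
    using assms by (intro lin_ext_subspace subspace_tensor_null) (auto intro!: pm_push_tensor_null)
  ultimately show ?thesis by simp
qed

lemma pm_bilinear_tensor_null_right:
  assumes "\<And>b b'. (b, b') \<in> Poly_Mapping.keys p \<Longrightarrow> f b \<in> lin_maps A A' \<and> g b' \<in> lin_maps B B'"
    and "r \<in> tensor_null A B"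
  shows "pm_bilinear (\<lambda>(b, b') (v, w). (f b v, g b' w)) p r \<in> tensor_null A' B'"
proof -
  have "pm_bilinear (\<lambda>(b, b') (v, w). (f b v, g b' w)) p r =
      lin_ext (\<lambda>(b, b'). pm_push (map_prod (f b) (g b')) r) p"
    by (simp add: pm_bilinear_eq_lin_ext case_prod_unfold map_prod_def)
  moreover have "lin_ext (\<lambda>(b, b'). pm_push (map_prod (f b) (g b')) r) p \<in> tensor_null A' B'"
    using assms by (intro lin_ext_subspace subspace_tensor_null) (auto intro!: pm_push_tensor_null)
  ultimately show ?thesis by simp
qed

lemma tensor_quotient:
  assumes A: "Module.module complex_ring A" and B: "Module.module complex_ring B"
  shows "pm_quotient (free_tensor A B) (tensor_null A B)"
proof
  interpret A: Module.module complex_ring A by fact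
  interpret B: Module.module complex_ring B by fact
  have [simp]: "c \<in> carrier complex_ring" for c by (simp add: ring_of_type_algebra_def)
  show "pm.subspace (carrier (free_tensor A B))"
    by (simp add: carrier_free_tensor subspace_supported)
  then show "tensor_null A B \<subseteq> carrier (free_tensor A B)"
    by (intro tensor_null_minimal pm.subspace_diff pm.subspace_scale)
       (simp_all add: carrier_free_tensor)
qed (simp_all add: free_tensor_def subspace_tensor_null)

section \<open>Tensor products of modules\<close>

text \<open>
  Being a module depends on the carrier, the addition, the zero and the scalars; this allows a change of the
  action, and of the type of the additional record fields.
\<close>

lemma module_same_ops:
  assumes M: "Module.module R M"
    and eq: "carrier M' = carrier M" "ring.add M' = ring.add M" "ring.zero M' = ring.zero M"
      "module.smult M' = module.smult M"
  shows "Module.module R M'"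
proof -
  interpret M: Module.module R M by fact
  show ?thesis
  proof (rule moduleI)
    show "abelian_group M'"
      by (rule abelian_groupI)
         (use M.add.l_inv_ex in \<open>auto simp: eq M.a_assoc intro: M.a_comm\<close>)
  qed (simp_all add: eq M.is_cring M.smult_l_distr M.smult_r_distr M.smult_assoc1)
qed

text \<open>
  The properties of a coproduct \<open>B \<rightarrow> B \<otimes> B\<close> which make tensor products into modules, in terms of the sets
  \<open>D x\<close> of representatives: \<open>D x\<close> is a nonempty set of mutually equivalent representatives, and the operations of
  the algebra are followed by the representatives.
\<close>

locale coproduct_on =
  fixes B :: "(complex, 'u, 'x) module_scheme" and D :: "'u \<Rightarrow> ('u \<times> 'u \<Rightarrow>\<^sub>0 complex) set"
  assumes B_closed: "\<one>\<^bsub>B\<^esub> \<in> carrier B"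
      "\<And>x y. x \<in> carrier B \<Longrightarrow> y \<in> carrier B \<Longrightarrow> x \<oplus>\<^bsub>B\<^esub> y \<in> carrier B"
      "\<And>x y. x \<in> carrier B \<Longrightarrow> y \<in> carrier B \<Longrightarrow> x \<otimes>\<^bsub>B\<^esub> y \<in> carrier B"
      "\<And>c x. x \<in> carrier B \<Longrightarrow> c \<odot>\<^bsub>B\<^esub> x \<in> carrier B"
    and D_keys: "\<And>x p. x \<in> carrier B \<Longrightarrow> p \<in> D x \<Longrightarrow> Poly_Mapping.keys p \<subseteq> carrier B \<times> carrier B"
    and D_nonempty: "\<And>x. x \<in> carrier B \<Longrightarrow> \<exists>p. p \<in> D x"
    and D_diff: "\<And>x p r. x \<in> carrier B \<Longrightarrow> p \<in> D x \<Longrightarrow> r \<in> D x \<Longrightarrow> p - r \<in> tensor_null B B"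
    and D_one: "Poly_Mapping.single (\<one>\<^bsub>B\<^esub>, \<one>\<^bsub>B\<^esub>) 1 \<in> D \<one>\<^bsub>B\<^esub>"
    and D_add: "\<And>x y p r. x \<in> carrier B \<Longrightarrow> y \<in> carrier B \<Longrightarrow> p \<in> D x \<Longrightarrow> r \<in> D y \<Longrightarrow> p + r \<in> D (x \<oplus>\<^bsub>B\<^esub> y)"
    and D_smult: "\<And>c x p. x \<in> carrier B \<Longrightarrow> p \<in> D x \<Longrightarrow> pm_scale c p \<in> D (c \<odot>\<^bsub>B\<^esub> x)"
    and D_mult: "\<And>x y p r. x \<in> carrier B \<Longrightarrow> y \<in> carrier B \<Longrightarrow> p \<in> D x \<Longrightarrow> r \<in> D y \<Longrightarrow>
      p \<otimes>\<^bsub>free_tensor B B\<^esub> r \<in> D (x \<otimes>\<^bsub>B\<^esub> y)"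
begin

text \<open>
  The action may be computed with any one choice of representatives, since another choice changes
  the result by relations.
\<close>

lemma act_tensor_amodule:
  assumes V: "alg_module B V" and W: "alg_module B W"
    and x: "x \<in> carrier B" and p: "p \<in> D x" and r: "Poly_Mapping.keys r \<subseteq> carrier V \<times> carrier W"
  shows "act (tensor_amodule D V W) x (pm_coset (tensor_null V W) r) =
    pm_coset (tensor_null V W) (pm_bilinear (\<lambda>(b, b') (v, w). (act V b v, act W b' w)) p r)"
proof -
  let ?g = "\<lambda>(b, b') (v, w). (act V b v, act W b' w)" and ?N = "tensor_null V W"
  note sub = subspace_tensor_null[of V W]
  interpret Q: pm_quotient "free_tensor V W" "tensor_null V W"
    using V W by (intro tensor_quotient) (simp_all add: alg_module_def)
  have lin: "act V b \<in> lin_maps V V" "act W b \<in> lin_maps W W" if "b \<in> carrier B" for b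
    using V W that by (auto simp: alg_module_def lin_maps_def)
  have lin': "v \<in> carrier V \<Longrightarrow> (\<lambda>b. act V b v) \<in> lin_maps B V"
    "w \<in> carrier W \<Longrightarrow> (\<lambda>b. act W b w) \<in> lin_maps B W" for v w
    using V W by (auto simp: alg_module_def lin_maps_def)
  have *: "pm_coset ?N (pm_bilinear ?g p' r') = pm_coset ?N (pm_bilinear ?g p r)"
    if p': "p' \<in> D x" and r': "r' \<in> pm_coset ?N r" for p' r'
  proof -
    have "r' - r \<in> ?N" using r' by (simp add: pm_coset_def)
    then have "Poly_Mapping.keys (r' - r) \<subseteq> carrier V \<times> carrier W"
      using Q.N_subset by (auto simp: carrier_free_tensor)
    then have keys: "Poly_Mapping.keys r' \<subseteq> carrier V \<times> carrier W"
      using r keys_add[of "r' - r" r] by auto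
    have "pm_bilinear ?g (p' - p) r' \<in> ?N"
      using keys lin' by (intro pm_bilinear_tensor_null_left[OF _ D_diff[OF x p' p]]) auto
    moreover have "pm_bilinear ?g p (r' - r) \<in> ?N"
      using D_keys[OF x p] lin by (intro pm_bilinear_tensor_null_right[OF _ \<open>r' - r \<in> ?N\<close>]) auto
    ultimately have "pm_bilinear ?g (p' - p) r' + pm_bilinear ?g p (r' - r) \<in> ?N"
      by (rule pm.subspace_add[OF sub])
    then show ?thesis
      by (simp add: pm_coset_eq_iff[OF sub] pm_bilinear_diff_left pm_bilinear_diff_right)
  qed
  have "act (tensor_amodule D V W) x (pm_coset ?N r) =
      (\<Union>p'\<in>D x. \<Union>r'\<in>pm_coset ?N r. pm_coset ?N (pm_bilinear ?g p' r'))"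
    by (simp add: tensor_amodule_def module.defs amodule.defs a_r_coset_eq_pm_coset[OF Q.add_F])
  also have "\<dots> = pm_coset ?N (pm_bilinear ?g p r)"
    using * p pm_coset_self[OF sub, of r] by blast
  finally show ?thesis .
qed

text \<open>
  With representatives at hand, each module axiom for \<open>V \<otimes> W\<close> is an identity for finitely supported functions
  that follows from the same axiom for \<open>V\<close> and \<open>W\<close> and from the corresponding rule for the coproduct.
\<close>

lemma alg_module_tensor_amodule:
  assumes V: "alg_module B V" and W: "alg_module B W"
  shows "alg_module B (tensor_amodule D V W)"
proof -
  let ?g = "\<lambda>(b, b') (v, w). (act V b v, act W b' w)" and ?N = "tensor_null V W" and ?T = "tensor_amodule D V W"
  interpret Q: pm_quotient "free_tensor V W" "tensor_null V W"
    using V W by (intro tensor_quotient) (simp_all add: alg_module_def)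
  note act = act_tensor_amodule[OF V W]
  have fields: "carrier ?T = carrier (tensor V W)" "ring.add ?T = ring.add (tensor V W)"
    "ring.zero ?T = ring.zero (tensor V W)" "module.smult ?T = module.smult (tensor V W)"
    by (simp_all add: tensor_amodule_def module.defs amodule.defs)
  note ops = Q.add_quot[folded tensor_def] Q.smult_quot[folded tensor_def]
  have actV: "b \<in> carrier B \<Longrightarrow> v \<in> carrier V \<Longrightarrow> act V b v \<in> carrier V" for b v
    using V by (simp add: alg_module_def)
  have actW: "b \<in> carrier B \<Longrightarrow> v \<in> carrier W \<Longrightarrow> act W b v \<in> carrier W" for b v
    using W by (simp add: alg_module_def)
  have multV: "act V (b \<otimes>\<^bsub>B\<^esub> b') v = act V b (act V b' v)"
    if "b \<in> carrier B" "b' \<in> carrier B" "v \<in> carrier V" for b b' v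
    using V that by (simp add: alg_module_def)
  have multW: "act W (b \<otimes>\<^bsub>B\<^esub> b') v = act W b (act W b' v)"
    if "b \<in> carrier B" "b' \<in> carrier B" "v \<in> carrier W" for b b' v
    using W that by (simp add: alg_module_def)
  have oneV: "v \<in> carrier V \<Longrightarrow> act V \<one>\<^bsub>B\<^esub> v = v" and oneW: "w \<in> carrier W \<Longrightarrow> act W \<one>\<^bsub>B\<^esub> w = w" for v w
    using V W by (simp_all add: alg_module_def)
  have T: "\<exists>r. Poly_Mapping.keys r \<subseteq> carrier V \<times> carrier W \<and> t = pm_coset ?N r" if "t \<in> carrier ?T" for t
    using that by (auto simp: fields tensor_def Q.carrier_quot carrier_free_tensor)
  have T': "pm_coset ?N r \<in> carrier ?T" if "Poly_Mapping.keys r \<subseteq> carrier V \<times> carrier W" for r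
    using that by (auto simp: fields tensor_def Q.carrier_quot carrier_free_tensor)
  have keys: "Poly_Mapping.keys (pm_bilinear ?g p r) \<subseteq> carrier V \<times> carrier W"
    if "x \<in> carrier B" "p \<in> D x" "Poly_Mapping.keys r \<subseteq> carrier V \<times> carrier W" for x p r
  proof (rule keys_pm_bilinear)
    fix y z assume "y \<in> Poly_Mapping.keys p" "z \<in> Poly_Mapping.keys r"
    then have "y \<in> carrier B \<times> carrier B" "z \<in> carrier V \<times> carrier W"
      using D_keys[OF that(1,2)] that(3) by auto
    then show "?g y z \<in> carrier V \<times> carrier W" by (simp add: case_prod_unfold mem_Times_iff actV actW)
  qed
  have keys_plus: "Poly_Mapping.keys (r + r') \<subseteq> S" if "Poly_Mapping.keys r \<subseteq> S" "Poly_Mapping.keys r' \<subseteq> S"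
    for r r' :: "'v \<times> 'w \<Rightarrow>\<^sub>0 complex" and S using that keys_add[of r r'] by blast
  show ?thesis
    unfolding alg_module_def
  proof (intro conjI ballI allI)
    have "Module.module complex_ring (tensor V W)" using Q.module_quot by (simp add: tensor_def)
    then show "Module.module complex_ring ?T"
      by (rule module_same_ops) (simp_all add: fields)
  next
    fix x t assume x: "x \<in> carrier B" and t: "t \<in> carrier ?T"
    obtain r p where r: "Poly_Mapping.keys r \<subseteq> carrier V \<times> carrier W" "t = pm_coset ?N r" "p \<in> D x"
      using T[OF t] D_nonempty[OF x] by auto
    then show "act ?T x t \<in> carrier ?T" using act[OF x r(3,1)] T'[OF keys[OF x r(3,1)]] by simp
  next
    fix x t t' assume x: "x \<in> carrier B" and t: "t \<in> carrier ?T" "t' \<in> carrier ?T"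
    obtain r r' p where "Poly_Mapping.keys r \<subseteq> carrier V \<times> carrier W" "t = pm_coset ?N r"
      "Poly_Mapping.keys r' \<subseteq> carrier V \<times> carrier W" "t' = pm_coset ?N r'" "p \<in> D x"
      using T[OF t(1)] T[OF t(2)] D_nonempty[OF x] by auto
    then show "act ?T x (t \<oplus>\<^bsub>?T\<^esub> t') = act ?T x t \<oplus>\<^bsub>?T\<^esub> act ?T x t'"
      using x by (simp add: fields ops act keys_plus pm_bilinear_add_right)
  next
    fix x y t assume x: "x \<in> carrier B" and y: "y \<in> carrier B" and t: "t \<in> carrier ?T"
    obtain r p p' where "Poly_Mapping.keys r \<subseteq> carrier V \<times> carrier W" "t = pm_coset ?N r"
      "p \<in> D x" "p' \<in> D y"
      using T[OF t] D_nonempty[OF x] D_nonempty[OF y] by auto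
    then show "act ?T (x \<oplus>\<^bsub>B\<^esub> y) t = act ?T x t \<oplus>\<^bsub>?T\<^esub> act ?T y t"
      using x y by (simp add: fields ops act D_add B_closed act[where p = "p + p'"] pm_bilinear_add_left)
  next
    fix c x t assume x: "x \<in> carrier B" and t: "t \<in> carrier ?T"
    obtain r p where r: "Poly_Mapping.keys r \<subseteq> carrier V \<times> carrier W" "t = pm_coset ?N r" "p \<in> D x"
      using T[OF t] D_nonempty[OF x] by auto
    have keys_c: "Poly_Mapping.keys (pm_scale c r) \<subseteq> carrier V \<times> carrier W"
      by (rule subset_trans[OF keys_pm_scale r(1)])
    show "act ?T x (c \<odot>\<^bsub>?T\<^esub> t) = c \<odot>\<^bsub>?T\<^esub> act ?T x t"
      by (simp only: fields ops r(2) act[OF x r(3,1)] act[OF x r(3) keys_c] pm_bilinear_scale_right)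
    show "act ?T (c \<odot>\<^bsub>B\<^esub> x) t = c \<odot>\<^bsub>?T\<^esub> act ?T x t"
      by (simp only: fields ops r(2) act[OF x r(3,1)] act[OF B_closed(4)[OF x] D_smult[OF x r(3)] r(1)]
            pm_bilinear_scale_left)
  next
    fix x y t assume x: "x \<in> carrier B" and y: "y \<in> carrier B" and t: "t \<in> carrier ?T"
    obtain r p p' where r: "Poly_Mapping.keys r \<subseteq> carrier V \<times> carrier W" "t = pm_coset ?N r"
      "p \<in> D x" "p' \<in> D y"
      using T[OF t] D_nonempty[OF x] D_nonempty[OF y] by auto
    have "pm_bilinear ?g (p \<otimes>\<^bsub>free_tensor B B\<^esub> p') r = pm_bilinear ?g p (pm_bilinear ?g p' r)"
      unfolding free_tensor_def ring.simps monoid.simps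
    proof (rule pm_bilinear_assoc)
      fix u v w
      assume "u \<in> Poly_Mapping.keys p" "v \<in> Poly_Mapping.keys p'" "w \<in> Poly_Mapping.keys r"
      then have "u \<in> carrier B \<times> carrier B" "v \<in> carrier B \<times> carrier B" "w \<in> carrier V \<times> carrier W"
        using D_keys[OF x r(3)] D_keys[OF y r(4)] r(1) by blast+
      then show "?g ((\<lambda>(a, b) (a', b'). (a \<otimes>\<^bsub>B\<^esub> a', b \<otimes>\<^bsub>B\<^esub> b')) u v) w = ?g u (?g v w)"
        by (simp add: case_prod_unfold mem_Times_iff multV multW)
    qed
    then show "act ?T (x \<otimes>\<^bsub>B\<^esub> y) t = act ?T x (act ?T y t)"
      using r act[OF B_closed(3)[OF x y] D_mult[OF x y r(3,4)] r(1)] act[OF y r(4,1)]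
        act[OF x r(3) keys[OF y r(4,1)]] by simp
  next
    fix t assume t: "t \<in> carrier ?T"
    obtain r where r: "Poly_Mapping.keys r \<subseteq> carrier V \<times> carrier W" "t = pm_coset ?N r" using T[OF t] by auto
    have "pm_bilinear ?g (Poly_Mapping.single (\<one>\<^bsub>B\<^esub>, \<one>\<^bsub>B\<^esub>) 1) r = r"
      unfolding pm_bilinear_eq_lin_ext lin_ext_single pm.scale_one
    proof (rule pm_push_id)
      fix z assume "z \<in> Poly_Mapping.keys r"
      then have "z \<in> carrier V \<times> carrier W" using r(1) by blast
      then show "?g (\<one>\<^bsub>B\<^esub>, \<one>\<^bsub>B\<^esub>) z = z" by (simp add: case_prod_unfold mem_Times_iff oneV oneW)
    qed
    then show "act ?T \<one>\<^bsub>B\<^esub> t = t" using act[OF B_closed(1) D_one r(1)] r by simp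
  qed
qed

end

section \<open>The quantum loop algebra and its Borel subalgebra\<close>

text \<open>
  The scalars in a monoid algebra are the multiples of the neutral element, which commute with
  every basis element.
\<close>

lemma scalar_central:
  fixes p :: "'m::monoid_add \<Rightarrow>\<^sub>0 complex"
  shows "p * Poly_Mapping.single 0 c = Poly_Mapping.single 0 c * p"
proof -
  have "Vector_Spaces.linear pm_scale pm_scale (\<lambda>p::'m \<Rightarrow>\<^sub>0 complex. p * Poly_Mapping.single 0 c)"
    "Vector_Spaces.linear pm_scale pm_scale (pm_scale c :: ('m \<Rightarrow>\<^sub>0 complex) \<Rightarrow> _)"
    by (simp_all add: Vector_Spaces.linear_def module_hom_def module_hom_axioms_def pm.vector_space_axioms
          pm.module_axioms distrib_right pm.scale_right_distrib mult.commute)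
       (simp add: mult_map_scale_conv_mult mult.assoc)
  from linear_eq_lin_ext[OF this(1)] linear_eq_lin_ext[OF this(2)]
  have "p * Poly_Mapping.single 0 c = pm_scale c p" by (simp add: mult_single)
  then show ?thesis by (simp add: mult_map_scale_conv_mult)
qed

lemma ring_free_alg: "ring free_alg"
  by (rule ringI, rule abelian_groupI)
     (auto simp: free_alg_def algebra_simps intro!: monoidI exI[of _ "- x" for x])

text \<open>
  A locale, because the development is instantiated twice: for \<open>q\<close> and for \<open>q\<inverse>\<close>.
\<close>

locale quantum_loop =
  fixes C :: "'k::finite \<Rightarrow> 'k \<Rightarrow> int" and d a :: "'k \<Rightarrow> nat" and q :: complex
begin

abbreviation "J \<equiv> Uq_ideal C d a q"
abbreviation "U \<equiv> Uq C d a q"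
abbreviation "B \<equiv> Uqb C d a q"
abbreviation "gen \<equiv> Ugen C d a q"

lemma ideal_J: "ideal J free_alg"
  unfolding Uq_ideal_def by (rule ring.genideal_ideal[OF ring_free_alg]) (simp add: free_alg_def)

sublocale Q: pm_quotient free_alg J
proof
  interpret ideal J free_alg by (rule ideal_J)
  show "pm.subspace J"
  proof (rule pm.subspaceI)
    show "0 \<in> J"
      using additive_subgroup.zero_closed[OF ideal.axioms(1)[OF ideal_J]] by (simp add: free_alg_def)
  next
    fix x y assume "x \<in> J" "y \<in> J"
    then show "x + y \<in> J" using additive_subgroup.a_closed[OF ideal.axioms(1)[OF ideal_J]] by (simp add: free_alg_def)
  next
    fix c x assume "x \<in> J"
    then show "pm_scale c x \<in> J"
      using I_l_closed[of x "Poly_Mapping.single 0 c"] by (simp add: free_alg_def mult_map_scale_conv_mult)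
  qed
qed (simp_all add: free_alg_def)

lemma carrier_U: "carrier U = range (pm_coset J)"
  unfolding Uq_def Q.carrier_quot by (simp add: free_alg_def)

lemma coset_in_U [simp]: "pm_coset J p \<in> carrier U"
  by (simp add: carrier_U)

lemma U_coset: "x \<in> carrier U \<Longrightarrow> \<exists>p. x = pm_coset J p"
  by (auto simp: carrier_U)

lemma add_U: "pm_coset J p \<oplus>\<^bsub>U\<^esub> pm_coset J r = pm_coset J (p + r)"
  unfolding Uq_def by (rule Q.add_quot)

lemma smult_U: "c \<odot>\<^bsub>U\<^esub> pm_coset J p = pm_coset J (pm_scale c p)"
  unfolding Uq_def by (rule Q.smult_quot)

lemma one_U: "\<one>\<^bsub>U\<^esub> = pm_coset J 1"
  unfolding Uq_def Q.one_quot by (simp add: free_alg_def)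

lemma mult_U: "pm_coset J p \<otimes>\<^bsub>U\<^esub> pm_coset J r = pm_coset J (p * r)"
  using ideal.rcoset_mult_add[OF ideal_J, of p r]
  unfolding a_r_coset_eq_pm_coset[OF Q.add_F]
  by (simp add: Uq_def quot_alg_def ring.defs module.defs FactRing_def free_alg_def)

sublocale M: Module.module complex_ring U
  unfolding Uq_def by (rule Q.module_quot)

sublocale U: ring U
proof (rule ringI)
  show "abelian_group U" by (rule M.abelian_group_axioms)
  show "monoid U"
  proof (rule monoidI)
    fix x y z assume "x \<in> carrier U" "y \<in> carrier U" "z \<in> carrier U"
    then obtain p r s where "x = pm_coset J p" "y = pm_coset J r" "z = pm_coset J s" using U_coset by metis
    then show "x \<otimes>\<^bsub>U\<^esub> y \<otimes>\<^bsub>U\<^esub> z = x \<otimes>\<^bsub>U\<^esub> (y \<otimes>\<^bsub>U\<^esub> z)" by (simp add: mult_U mult.assoc)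
  next
    fix x y assume "x \<in> carrier U" "y \<in> carrier U"
    then obtain p r where "x = pm_coset J p" "y = pm_coset J r" using U_coset by metis
    then show "x \<otimes>\<^bsub>U\<^esub> y \<in> carrier U" by (simp add: mult_U)
  next
    fix x assume "x \<in> carrier U"
    then obtain p where "x = pm_coset J p" using U_coset by metis
    then show "\<one>\<^bsub>U\<^esub> \<otimes>\<^bsub>U\<^esub> x = x" "x \<otimes>\<^bsub>U\<^esub> \<one>\<^bsub>U\<^esub> = x" by (simp_all add: mult_U one_U)
  qed (simp add: one_U)
next
  fix x y z assume "x \<in> carrier U" "y \<in> carrier U" "z \<in> carrier U"
  then obtain p r s where "x = pm_coset J p" "y = pm_coset J r" "z = pm_coset J s" using U_coset by metis
  then show "(x \<oplus>\<^bsub>U\<^esub> y) \<otimes>\<^bsub>U\<^esub> z = x \<otimes>\<^bsub>U\<^esub> z \<oplus>\<^bsub>U\<^esub> y \<otimes>\<^bsub>U\<^esub> z"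
    and "z \<otimes>\<^bsub>U\<^esub> (x \<oplus>\<^bsub>U\<^esub> y) = z \<otimes>\<^bsub>U\<^esub> x \<oplus>\<^bsub>U\<^esub> z \<otimes>\<^bsub>U\<^esub> y"
    by (simp_all add: mult_U add_U algebra_simps)
qed

lemma smult_closed_U [simp]: "x \<in> carrier U \<Longrightarrow> c \<odot>\<^bsub>U\<^esub> x \<in> carrier U"
  by (rule M.smult_closed) (simp_all add: ring_of_type_algebra_def)

lemma smult_eq_mult: "x \<in> carrier U \<Longrightarrow> c \<odot>\<^bsub>U\<^esub> x = (c \<odot>\<^bsub>U\<^esub> \<one>\<^bsub>U\<^esub>) \<otimes>\<^bsub>U\<^esub> x"
  using U_coset[of x] by (auto simp: smult_U one_U mult_U mult_map_scale_conv_mult)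

lemma mult_smult_right:
  assumes "x \<in> carrier U" "y \<in> carrier U"
  shows "x \<otimes>\<^bsub>U\<^esub> (c \<odot>\<^bsub>U\<^esub> y) = c \<odot>\<^bsub>U\<^esub> (x \<otimes>\<^bsub>U\<^esub> y)"
proof -
  obtain p r where "x = pm_coset J p" "y = pm_coset J r" using assms U_coset by metis
  then show ?thesis by (simp add: smult_U mult_U mult_map_scale_conv_mult flip: mult.assoc) (simp add: scalar_central)
qed

lemma smult_one_U: "x \<in> carrier U \<Longrightarrow> 1 \<odot>\<^bsub>U\<^esub> x = x"
  using M.smult_one by (simp add: ring_of_type_algebra_def)

lemma a_inv_U: "x \<in> carrier U \<Longrightarrow> \<ominus>\<^bsub>U\<^esub> x = (- 1) \<odot>\<^bsub>U\<^esub> x"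
proof -
  assume x: "x \<in> carrier U"
  obtain p where p: "x = pm_coset J p" using x U_coset by metis
  have "x \<oplus>\<^bsub>U\<^esub> ((- 1) \<odot>\<^bsub>U\<^esub> x) = \<zero>\<^bsub>U\<^esub>"
    using Q.zero_quot by (simp add: p smult_U add_U Uq_def[symmetric])
  then show ?thesis using x by (intro abelian_group.minus_equality[OF M.abelian_group_axioms]) (simp_all add: M.a_comm)
qed

lemma gen_in_U [simp]: "gen g \<in> carrier U"
  by (simp add: Ugen_def a_r_coset_eq_pm_coset[OF Q.add_F])

lemma K_Kinv: "gen (Kgen i) \<otimes>\<^bsub>U\<^esub> gen (Kinvgen i) = \<one>\<^bsub>U\<^esub>"
  and Kinv_K: "gen (Kinvgen i) \<otimes>\<^bsub>U\<^esub> gen (Kgen i) = \<one>\<^bsub>U\<^esub>"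
proof -
  have sub: "qrels C d a q \<subseteq> J"
    unfolding Uq_ideal_def by (rule ring.genideal_self[OF ring_free_alg]) (simp add: free_alg_def)
  have "fgen (Kgen i) * fgen (Kinvgen i) - 1 \<in> qrels C d a q"
    "fgen (Kinvgen i) * fgen (Kgen i) - 1 \<in> qrels C d a q"
    unfolding qrels_def Let_def by blast+
  then show "gen (Kgen i) \<otimes>\<^bsub>U\<^esub> gen (Kinvgen i) = \<one>\<^bsub>U\<^esub>" "gen (Kinvgen i) \<otimes>\<^bsub>U\<^esub> gen (Kgen i) = \<one>\<^bsub>U\<^esub>"
    using sub by (auto simp: Ugen_def a_r_coset_eq_pm_coset[OF Q.add_F] mult_U one_U pm_coset_eq_iff[OF Q.subspace_N])
qed

lemma B_simps [simp]: "\<one>\<^bsub>B\<^esub> = \<one>\<^bsub>U\<^esub>" "monoid.mult B = monoid.mult U" "ring.add B = ring.add U"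
  "ring.zero B = ring.zero U" "module.smult B = module.smult U"
  by (simp_all add: Uqb_def)

abbreviation "Bgens \<equiv> range (\<lambda>c. c \<odot>\<^bsub>U\<^esub> \<one>\<^bsub>U\<^esub>) \<union> gen ` (range Egen \<union> range Kgen \<union> range Kinvgen)"

lemma carrier_B: "carrier B = generate_ring U Bgens"
  by (simp add: Uqb_def generate_alg_def)

lemma B_subset_U: "x \<in> carrier B \<Longrightarrow> x \<in> carrier U"
  unfolding carrier_B by (rule U.generate_ring_in_carrier[rotated]) auto

lemma gens_in_B [simp]: "gen (Egen i) \<in> carrier B" "gen (Kgen i) \<in> carrier B" "gen (Kinvgen i) \<in> carrier B"
  "c \<odot>\<^bsub>U\<^esub> \<one>\<^bsub>U\<^esub> \<in> carrier B"
  unfolding carrier_B by (rule generate_ring.incl; blast)+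

lemma one_in_B [simp]: "\<one>\<^bsub>U\<^esub> \<in> carrier B"
  unfolding carrier_B by (rule generate_ring.one)

lemma add_in_B: "x \<in> carrier B \<Longrightarrow> y \<in> carrier B \<Longrightarrow> x \<oplus>\<^bsub>U\<^esub> y \<in> carrier B"
  and mult_in_B: "x \<in> carrier B \<Longrightarrow> y \<in> carrier B \<Longrightarrow> x \<otimes>\<^bsub>U\<^esub> y \<in> carrier B"
  unfolding carrier_B by (rule generate_ring.eng_add generate_ring.eng_mult; assumption)+

lemma smult_in_B: "x \<in> carrier B \<Longrightarrow> c \<odot>\<^bsub>U\<^esub> x \<in> carrier B"
  using mult_in_B[OF gens_in_B(4)] by (simp add: smult_eq_mult[of x c] B_subset_U)

text \<open>
  Negatives are multiples by the scalar \<open>-1\<close>, so they need no case of their own in an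
  induction over the Borel subalgebra.
\<close>

lemma Uqb_induct [consumes 1, case_names scalar E K Kinv add mult]:
  assumes "x \<in> carrier B"
    and scalar: "\<And>c. P (c \<odot>\<^bsub>U\<^esub> \<one>\<^bsub>U\<^esub>)"
    and E: "\<And>i. P (gen (Egen i))" and K: "\<And>i. P (gen (Kgen i))" and Kinv: "\<And>i. P (gen (Kinvgen i))"
    and add: "\<And>x y. x \<in> carrier B \<Longrightarrow> y \<in> carrier B \<Longrightarrow> P x \<Longrightarrow> P y \<Longrightarrow> P (x \<oplus>\<^bsub>U\<^esub> y)"
    and mult: "\<And>x y. x \<in> carrier B \<Longrightarrow> y \<in> carrier B \<Longrightarrow> P x \<Longrightarrow> P y \<Longrightarrow> P (x \<otimes>\<^bsub>U\<^esub> y)"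
  shows "P x"
proof -
  have "x \<in> generate_ring U Bgens" using assms(1) by (simp only: carrier_B)
  then show ?thesis
  proof (induction rule: generate_ring.induct)
    case one
    show ?case using scalar[of 1] by (simp add: smult_one_U)
  next
    case (incl x)
    then show ?case using scalar E K Kinv by blast
  next
    case (a_inv x)
    then have x: "x \<in> carrier B" by (simp only: carrier_B)
    have "\<ominus>\<^bsub>U\<^esub> x = ((- 1) \<odot>\<^bsub>U\<^esub> \<one>\<^bsub>U\<^esub>) \<otimes>\<^bsub>U\<^esub> x"
      using B_subset_U[OF x] by (simp add: a_inv_U smult_eq_mult[of x "- 1"])
    then show ?case using mult[OF gens_in_B(4) x scalar a_inv.IH] by simp
  next
    case (eng_add x y)
    then show ?case by (intro add) (simp_all only: carrier_B)
  next
    case (eng_mult x y)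
    then show ?case by (intro mult) (simp_all only: carrier_B)
  qed
qed

text \<open>
  A subspace of a vector space has a linear complement. Complements are available for the free algebra,
  which is a vector space on a whole type: a linear retraction \<open>P\<close> onto the preimage \<open>S\<close> of \<open>B\<close> fixes the ideal
  \<open>J \<subseteq> S\<close> and hence descends to the quotient.
\<close>

lemma ex_projection_onto_B: "\<exists>\<pi>\<in>lin_maps U B. \<forall>x\<in>carrier B. \<pi> x = x"
proof -
  define S where "S = {p. pm_coset J p \<in> carrier B}"
  have zero_B: "pm_coset J 0 \<in> carrier B" 
    using smult_in_B[OF one_in_B, of 0] by (simp add: one_U smult_U)
  have S: "pm.subspace S"
    by (rule pm.subspaceI)
       (use zero_B add_in_B smult_in_B in \<open>simp_all add: S_def add_U[symmetric] smult_U[symmetric]\<close>)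
  have JS: "p \<in> S" if "p \<in> J" for p
  proof -
    have "pm_coset J p = pm_coset J 0" using that by (simp add: pm_coset_eq_iff[OF Q.subspace_N])
    then show ?thesis using zero_B by (simp add: S_def)
  qed
  interpret vp: vector_space_pair pm_scale "pm_scale :: complex \<Rightarrow> 'k qfree \<Rightarrow> 'k qfree" ..
  obtain P where P: "range P \<subseteq> S" "Vector_Spaces.linear pm_scale pm_scale P" "\<forall>p\<in>S. P p = p"
    using vp.linear_exists_left_inverse_on[OF pm.linear_id S] by auto
  interpret P: Vector_Spaces.linear pm_scale pm_scale P by (rule P)
  define \<pi> where "\<pi> x = pm_coset J (P (SOME p. p \<in> x))" for x
  have \<pi>: "\<pi> (pm_coset J p) = pm_coset J (P p)" for p
  proof -
    have "(SOME r. r \<in> pm_coset J p) \<in> pm_coset J p"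
      by (rule someI[of _ p]) (rule pm_coset_self[OF Q.subspace_N])
    then have r: "(SOME r. r \<in> pm_coset J p) - p \<in> J" by (simp add: pm_coset_def)
    then have "P ((SOME r. r \<in> pm_coset J p) - p) \<in> J" using JS P(3) by metis
    then show ?thesis unfolding \<pi>_def pm_coset_eq_iff[OF Q.subspace_N] P.diff .
  qed
  have "\<pi> \<in> lin_maps U B"
    unfolding lin_maps_def
  proof (intro CollectI conjI funcsetI ballI allI)
    fix x assume "x \<in> carrier U"
    then obtain p where "x = pm_coset J p" using U_coset by metis
    then show "\<pi> x \<in> carrier B" using P(1) \<pi> by (auto simp: S_def)
    show "\<pi> (c \<odot>\<^bsub>U\<^esub> x) = c \<odot>\<^bsub>B\<^esub> \<pi> x" for c
      using \<open>x = pm_coset J p\<close> by (simp add: \<pi> smult_U P.scale)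
  next
    fix x y assume "x \<in> carrier U" "y \<in> carrier U"
    then obtain p r where "x = pm_coset J p" "y = pm_coset J r" using U_coset by metis
    then show "\<pi> (x \<oplus>\<^bsub>U\<^esub> y) = \<pi> x \<oplus>\<^bsub>B\<^esub> \<pi> y" by (simp add: \<pi> add_U P.add)
  qed
  moreover have "\<pi> x = x" if x: "x \<in> carrier B" for x
  proof -
    obtain p where "x = pm_coset J p" using U_coset[OF B_subset_U[OF x]] by metis
    then show ?thesis using x P(3) by (simp add: \<pi> S_def)
  qed
  ultimately show ?thesis by blast
qed

text \<open>
  The map \<open>B \<otimes> B \<rightarrow> U \<otimes> U\<close> is injective. If \<open>\<pi>\<close> projects \<open>U\<close> onto \<open>B\<close>, then \<open>\<pi> \<otimes> \<pi>\<close> is a left inverse of it,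
  already on representatives.
\<close>

lemma tensor_null_B:
  assumes "p \<in> tensor_null U U" "Poly_Mapping.keys p \<subseteq> carrier B \<times> carrier B"
  shows "p \<in> tensor_null B B"
proof -
  obtain \<pi> where \<pi>: "\<pi> \<in> lin_maps U B" "\<forall>x\<in>carrier B. \<pi> x = x" using ex_projection_onto_B by blast
  have "pm_push (map_prod \<pi> \<pi>) p = p"
    by (rule pm_push_id) (use assms(2) \<pi>(2) in auto)
  then show ?thesis using pm_push_tensor_null[OF \<pi>(1) \<pi>(1) assms(1)] by simp
qed

end

section \<open>The coproduct on the Borel subalgebra\<close>

locale quantum_coproduct = quantum_loop C d a q
  for C :: "'k::finite \<Rightarrow> 'k \<Rightarrow> int" and d a :: "'k \<Rightarrow> nat" and q :: complex +
  fixes \<Delta> :: "'k qelem \<Rightarrow> ('k qelem \<times> 'k qelem \<Rightarrow>\<^sub>0 complex) set"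
  assumes coproduct: "is_coproduct C d a q \<Delta>"
begin

abbreviation "NU \<equiv> tensor_null U U"
abbreviation "k i \<equiv> gen (Kgen i)"
abbreviation "k' i \<equiv> gen (Kinvgen i)"
abbreviation "e i \<equiv> gen (Egen i)"

sublocale T: pm_quotient "free_tensor U U" NU
  by (intro tensor_quotient M.module_axioms)

lemma \<Delta>_hom: "\<Delta> \<in> ring_hom U (tensor U U)" "x \<in> carrier U \<Longrightarrow> \<Delta> (c \<odot>\<^bsub>U\<^esub> x) = c \<odot>\<^bsub>tensor U U\<^esub> \<Delta> x"
  using coproduct by (simp_all add: is_coproduct_def Let_def alg_hom_def)

lemma \<Delta>_closed: "x \<in> carrier U \<Longrightarrow> \<Delta> x \<in> carrier (quot_alg (free_tensor U U) NU)"
  using ring_hom_closed[OF \<Delta>_hom(1)] by (simp add: tensor_def)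

lemma \<Delta>_keys: "x \<in> carrier U \<Longrightarrow> p \<in> \<Delta> x \<Longrightarrow> Poly_Mapping.keys p \<subseteq> carrier U \<times> carrier U"
  using T.coset_of_mem(2)[OF \<Delta>_closed] by (simp add: carrier_free_tensor)

lemma \<Delta>_mem_iff:
  assumes "x \<in> carrier U" "p \<in> \<Delta> x"
  shows "r \<in> \<Delta> x \<longleftrightarrow> r - p \<in> NU"
proof -
  have "\<Delta> x = pm_coset NU p" by (rule T.coset_of_mem(1)[OF \<Delta>_closed[OF assms(1)] assms(2)])
  then show ?thesis by (simp add: pm_coset_def)
qed

lemma \<Delta>_nonempty: "x \<in> carrier U \<Longrightarrow> \<exists>p. p \<in> \<Delta> x"
  using T.quot_nonempty[OF \<Delta>_closed] .

lemma \<Delta>_one: "Poly_Mapping.single (\<one>\<^bsub>U\<^esub>, \<one>\<^bsub>U\<^esub>) 1 \<in> \<Delta> \<one>\<^bsub>U\<^esub>"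
proof -
  have "\<Delta> \<one>\<^bsub>U\<^esub> = pm_coset NU (Poly_Mapping.single (\<one>\<^bsub>U\<^esub>, \<one>\<^bsub>U\<^esub>) 1)"
    unfolding ring_hom_one[OF \<Delta>_hom(1)] tensor_def T.one_quot by (simp add: free_tensor_def)
  then show ?thesis by (simp add: pm_coset_self[OF T.subspace_N])
qed

lemma \<Delta>_add: "x \<in> carrier U \<Longrightarrow> y \<in> carrier U \<Longrightarrow> p \<in> \<Delta> x \<Longrightarrow> r \<in> \<Delta> y \<Longrightarrow> p + r \<in> \<Delta> (x \<oplus>\<^bsub>U\<^esub> y)"
  using T.add_mem_quot by (simp add: ring_hom_add[OF \<Delta>_hom(1)] tensor_def)

lemma \<Delta>_smult: "x \<in> carrier U \<Longrightarrow> p \<in> \<Delta> x \<Longrightarrow> pm_scale c p \<in> \<Delta> (c \<odot>\<^bsub>U\<^esub> x)"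
  using T.smult_mem_quot by (simp add: \<Delta>_hom(2) tensor_def)

lemma \<Delta>_mult:
  "x \<in> carrier U \<Longrightarrow> y \<in> carrier U \<Longrightarrow> p \<in> \<Delta> x \<Longrightarrow> r \<in> \<Delta> y \<Longrightarrow> p \<otimes>\<^bsub>free_tensor U U\<^esub> r \<in> \<Delta> (x \<otimes>\<^bsub>U\<^esub> y)"
  using T.mult_mem_quot by (simp add: ring_hom_mult[OF \<Delta>_hom(1)] tensor_def)

lemma mult_single_free_tensor:
  "Poly_Mapping.single (x, y) c \<otimes>\<^bsub>free_tensor U U\<^esub> p =
    pm_scale c (pm_push (map_prod (\<lambda>z. x \<otimes>\<^bsub>U\<^esub> z) (\<lambda>z. y \<otimes>\<^bsub>U\<^esub> z)) p)"
  by (simp add: free_tensor_def pm_bilinear_eq_lin_ext case_prod_unfold map_prod_def)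

lemma single_in_pure_tensor: "Poly_Mapping.single (x, y) 1 \<in> pure_tensor U U x y"
  unfolding pure_tensor_def a_r_coset_eq_pm_coset[OF T.add_F] by (rule pm_coset_self[OF T.subspace_N])

lemma \<Delta>_E: "Poly_Mapping.single (e i, \<one>\<^bsub>U\<^esub>) 1 + Poly_Mapping.single (k i, e i) 1 \<in> \<Delta> (e i)"
proof -
  have "\<Delta> (e i) = pure_tensor U U (e i) \<one>\<^bsub>U\<^esub> \<oplus>\<^bsub>tensor U U\<^esub> pure_tensor U U (k i) (e i)"
    using coproduct by (simp add: is_coproduct_def Let_def)
  then show ?thesis unfolding tensor_def by (simp only: T.add_mem_quot single_in_pure_tensor)
qed

lemma \<Delta>_K: "Poly_Mapping.single (k i, k i) 1 \<in> \<Delta> (k i)"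
  using coproduct by (simp add: is_coproduct_def Let_def single_in_pure_tensor)

text \<open>
  The defining conditions on \<open>\<Delta>\<close> give its value on \<open>k\<^sub>i\<close>, and \<open>\<Delta> (k\<^sub>i\<inverse>)\<close> has to be the inverse of
  \<open>k\<^sub>i \<otimes> k\<^sub>i\<close>. For a representative \<open>p\<close> of \<open>\<Delta> (k\<^sub>i\<inverse>)\<close>, multiplication of \<open>(k\<^sub>i \<otimes> k\<^sub>i) p \<equiv> 1 \<otimes> 1\<close> by
  \<open>k\<^sub>i\<inverse> \<otimes> k\<^sub>i\<inverse>\<close> isolates \<open>p\<close>.
\<close>

lemma \<Delta>_Kinv: "Poly_Mapping.single (k' i, k' i) 1 \<in> \<Delta> (k' i)"
proof -
  let ?L = "\<lambda>z. k' i \<otimes>\<^bsub>U\<^esub> z"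
  obtain p where p: "p \<in> \<Delta> (k' i)" using \<Delta>_nonempty by fastforce
  have "Poly_Mapping.single (k i, k i) 1 \<otimes>\<^bsub>free_tensor U U\<^esub> p \<in> \<Delta> \<one>\<^bsub>U\<^esub>"
    using \<Delta>_mult[OF _ _ \<Delta>_K[of i] p] by (simp add: K_Kinv)
  then have "pm_push (map_prod (\<lambda>z. k i \<otimes>\<^bsub>U\<^esub> z) (\<lambda>z. k i \<otimes>\<^bsub>U\<^esub> z)) p - Poly_Mapping.single (\<one>\<^bsub>U\<^esub>, \<one>\<^bsub>U\<^esub>) 1 \<in> NU"
    using \<Delta>_mem_iff[OF U.one_closed \<Delta>_one] by (simp add: mult_single_free_tensor)
  moreover have "?L \<in> lin_maps U U"
    by (simp add: lin_maps_def U.r_distr mult_smult_right)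
  ultimately have "pm_push (map_prod ?L ?L)
      (pm_push (map_prod (\<lambda>z. k i \<otimes>\<^bsub>U\<^esub> z) (\<lambda>z. k i \<otimes>\<^bsub>U\<^esub> z)) p - Poly_Mapping.single (\<one>\<^bsub>U\<^esub>, \<one>\<^bsub>U\<^esub>) 1) \<in> NU"
    using pm_push_tensor_null by blast
  moreover have "pm_push (map_prod ?L ?L) (pm_push (map_prod (\<lambda>z. k i \<otimes>\<^bsub>U\<^esub> z) (\<lambda>z. k i \<otimes>\<^bsub>U\<^esub> z)) p) = p"
    unfolding lin_ext_comp lin_ext_single pm.scale_one
  proof (rule pm_push_id)
    fix z assume "z \<in> Poly_Mapping.keys p"
    then have "z \<in> carrier U \<times> carrier U" using \<Delta>_keys[OF gen_in_U p] by blast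
    then show "map_prod ?L ?L (map_prod (\<lambda>z. k i \<otimes>\<^bsub>U\<^esub> z) (\<lambda>z. k i \<otimes>\<^bsub>U\<^esub> z) z) = z"
      by (auto simp: U.m_assoc[symmetric] Kinv_K)
  qed
  ultimately have "p - Poly_Mapping.single (k' i, k' i) 1 \<in> NU" by (simp add: lin_ext.diff)
  then have "Poly_Mapping.single (k' i, k' i) 1 - p \<in> NU"
    using pm.subspace_neg[OF T.subspace_N] by fastforce
  then show ?thesis using \<Delta>_mem_iff[OF gen_in_U p] by simp
qed

lemma keys_mult_B:
  assumes "Poly_Mapping.keys p \<subseteq> carrier B \<times> carrier B" "Poly_Mapping.keys r \<subseteq> carrier B \<times> carrier B"
  shows "Poly_Mapping.keys (p \<otimes>\<^bsub>free_tensor U U\<^esub> r) \<subseteq> carrier B \<times> carrier B"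
  unfolding free_tensor_def monoid.simps
proof (rule keys_pm_bilinear)
  fix u v assume "u \<in> Poly_Mapping.keys p" "v \<in> Poly_Mapping.keys r"
  then have "u \<in> carrier B \<times> carrier B" "v \<in> carrier B \<times> carrier B" using assms by blast+
  then show "(case u of (a, b) \<Rightarrow> \<lambda>(a', b'). (a \<otimes>\<^bsub>U\<^esub> a', b \<otimes>\<^bsub>U\<^esub> b')) v \<in> carrier B \<times> carrier B"
    by (simp add: case_prod_unfold mem_Times_iff mult_in_B)
qed

text \<open>
  The coproduct maps \<open>B\<close> to the image of \<open>B \<otimes> B\<close>, because it does so on the generators.
\<close>

lemma restrict_coproduct_nonempty:
  assumes "x \<in> carrier B"
  shows "\<exists>p. p \<in> \<Delta> x \<and> Poly_Mapping.keys p \<subseteq> carrier B \<times> carrier B"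
  using assms
proof (induction rule: Uqb_induct)
  case (scalar c)
  show ?case using \<Delta>_smult[OF U.one_closed \<Delta>_one, of c] by (intro exI conjI) (auto split: if_splits)
next
  case (E i)
  have "Poly_Mapping.keys (Poly_Mapping.single (e i, \<one>\<^bsub>U\<^esub>) (1::complex) + Poly_Mapping.single (k i, e i) 1)
      \<subseteq> carrier B \<times> carrier B"
    by (rule subset_trans[OF keys_add]) simp
  then show ?case using \<Delta>_E by blast
next
  case (K i)
  show ?case using \<Delta>_K by (intro exI conjI) auto
next
  case (Kinv i)
  show ?case using \<Delta>_Kinv by (intro exI conjI) auto
next
  case (add x y)
  then obtain p r where pr: "p \<in> \<Delta> x" "Poly_Mapping.keys p \<subseteq> carrier B \<times> carrier B"
    "r \<in> \<Delta> y" "Poly_Mapping.keys r \<subseteq> carrier B \<times> carrier B" by blast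
  have "Poly_Mapping.keys (p + r) \<subseteq> carrier B \<times> carrier B"
    by (rule subset_trans[OF keys_add]) (use pr in simp)
  then show ?case using \<Delta>_add[OF _ _ pr(1,3)] add.hyps B_subset_U by blast
next
  case (mult x y)
  then obtain p r where pr: "p \<in> \<Delta> x" "Poly_Mapping.keys p \<subseteq> carrier B \<times> carrier B"
    "r \<in> \<Delta> y" "Poly_Mapping.keys r \<subseteq> carrier B \<times> carrier B" by blast
  have "Poly_Mapping.keys (p \<otimes>\<^bsub>free_tensor U U\<^esub> r) \<subseteq> carrier B \<times> carrier B"
    by (rule keys_mult_B) (use pr in simp_all)
  then show ?case using \<Delta>_mult[OF _ _ pr(1,3)] mult.hyps B_subset_U by blast
qed

lemma mem_restrict_coproduct:
  "p \<in> restrict_coproduct B \<Delta> x \<longleftrightarrow> p \<in> \<Delta> x \<and> Poly_Mapping.keys p \<subseteq> carrier B \<times> carrier B"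
  by (simp add: restrict_coproduct_def carrier_free_tensor)

lemma mult_free_tensor_B: "p \<otimes>\<^bsub>free_tensor B B\<^esub> r = p \<otimes>\<^bsub>free_tensor U U\<^esub> r"
  by (simp add: free_tensor_def)

sublocale D: coproduct_on B "restrict_coproduct B \<Delta>"
proof
  fix x y p r
  assume x: "x \<in> carrier B" and y: "y \<in> carrier B" and p: "p \<in> restrict_coproduct B \<Delta> x"
    and r: "r \<in> restrict_coproduct B \<Delta> y"
  note xy = B_subset_U[OF x] B_subset_U[OF y] and pr = p[unfolded mem_restrict_coproduct] r[unfolded mem_restrict_coproduct]
  show "p + r \<in> restrict_coproduct B \<Delta> (x \<oplus>\<^bsub>B\<^esub> y)"
    using \<Delta>_add[OF xy] pr subset_trans[OF keys_add[of p r]] by (simp add: mem_restrict_coproduct)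
  have "Poly_Mapping.keys (p \<otimes>\<^bsub>free_tensor U U\<^esub> r) \<subseteq> carrier B \<times> carrier B"
    by (rule keys_mult_B) (use pr in simp_all)
  then show "p \<otimes>\<^bsub>free_tensor B B\<^esub> r \<in> restrict_coproduct B \<Delta> (x \<otimes>\<^bsub>B\<^esub> y)"
    using \<Delta>_mult[OF xy] pr by (simp add: mem_restrict_coproduct mult_free_tensor_B)
next
  fix x p r
  assume x: "x \<in> carrier B" and "p \<in> restrict_coproduct B \<Delta> x" "r \<in> restrict_coproduct B \<Delta> x"
  then have pr: "p \<in> \<Delta> x" "Poly_Mapping.keys p \<subseteq> carrier B \<times> carrier B"
    "r \<in> \<Delta> x" "Poly_Mapping.keys r \<subseteq> carrier B \<times> carrier B"
    by (simp_all add: mem_restrict_coproduct)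
  show "p - r \<in> tensor_null B B"
  proof (rule tensor_null_B)
    show "p - r \<in> NU" using \<Delta>_mem_iff[OF B_subset_U[OF x] pr(3)] pr(1) by simp
    show "Poly_Mapping.keys (p - r) \<subseteq> carrier B \<times> carrier B"
      using pm.subspace_diff[OF subspace_supported, of p _ r] pr by simp
  qed
next
  fix c x p assume "x \<in> carrier B" "p \<in> restrict_coproduct B \<Delta> x"
  then show "pm_scale c p \<in> restrict_coproduct B \<Delta> (c \<odot>\<^bsub>B\<^esub> x)"
    using \<Delta>_smult[OF B_subset_U] subset_trans[OF keys_pm_scale[of c p]] by (simp add: mem_restrict_coproduct)
qed (use \<Delta>_one \<Delta>_keys restrict_coproduct_nonempty in
      \<open>simp_all add: mem_restrict_coproduct add_in_B mult_in_B smult_in_B\<close>)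

end

section \<open>The flip\<close>

lemma map_key_swap_eq_pm_push:
  fixes p :: "'a \<times> 'b \<Rightarrow>\<^sub>0 complex"
  shows "Poly_Mapping.map_key prod.swap p = pm_push prod.swap p"
proof -
  have "Vector_Spaces.linear pm_scale pm_scale (Poly_Mapping.map_key prod.swap :: ('a \<times> 'b \<Rightarrow>\<^sub>0 complex) \<Rightarrow> _)"
    by (simp add: Vector_Spaces.linear_def module_hom_def module_hom_axioms_def pm.vector_space_axioms
          pm.module_axioms map_key_plus map_key_map)
  moreover have "Poly_Mapping.map_key prod.swap (Poly_Mapping.single z (1::complex)) = Poly_Mapping.single (prod.swap z) 1"
    for z :: "'a \<times> 'b" by (cases z) (simp add: map_key_swap_single)
  ultimately show ?thesis by (simp add: linear_eq_lin_ext[of "Poly_Mapping.map_key prod.swap" p])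
qed

text \<open>
  The relations of \<open>A \<otimes> B\<close> and \<open>B \<otimes> A\<close> correspond under the swap, so the image of a coset is a whole coset.
\<close>

lemma flip_pm_coset:
  "flip (pm_coset (tensor_null A B) p) = pm_coset (tensor_null B A) (pm_push prod.swap p)"
proof -
  let ?s = "\<lambda>p. Poly_Mapping.map_key prod.swap p"
  have "flip (pm_coset (tensor_null A B) p) = pm_coset (tensor_null B A) (?s p)"
  proof (intro equalityI subsetI)
    fix r assume "r \<in> pm_coset (tensor_null B A) (?s p)"
    then have "?s (r - ?s p) \<in> tensor_null A B"
      using swap_tensor_null[of B A] by (auto simp: pm_coset_def)
    then have "?s r \<in> pm_coset (tensor_null A B) p"
      by (simp add: pm_coset_def map_key_minus map_key_swap_swap)
    then show "r \<in> flip (pm_coset (tensor_null A B) p)"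
      unfolding flip_def using map_key_swap_swap[of r] by (metis imageI)
  next
    fix r assume "r \<in> flip (pm_coset (tensor_null A B) p)"
    then obtain s where s: "s - p \<in> tensor_null A B" "r = ?s s" by (auto simp: flip_def pm_coset_def)
    then have "?s (s - p) \<in> tensor_null B A" using swap_tensor_null[of A B] by blast
    then show "r \<in> pm_coset (tensor_null B A) (?s p)" by (simp add: s pm_coset_def map_key_minus)
  qed
  then show ?thesis by (simp only: map_key_swap_eq_pm_push)
qed

lemma flip_flip: "flip (flip t) = t"
  by (simp add: flip_def image_image map_key_swap_swap)

lemma flip_carrier:
  assumes A: "Module.module complex_ring A" and B: "Module.module complex_ring B"
    and t: "t \<in> carrier (tensor A B)"
  shows "flip t \<in> carrier (tensor B A)"
proof -
  obtain r where r: "Poly_Mapping.keys r \<subseteq> carrier A \<times> carrier B" "t = pm_coset (tensor_null A B) r"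
    using t unfolding tensor_def pm_quotient.carrier_quot[OF tensor_quotient[OF A B]] carrier_free_tensor by blast
  have "Poly_Mapping.keys (pm_push prod.swap r) \<subseteq> carrier B \<times> carrier A"
    by (rule subset_trans[OF keys_pm_push]) (use r(1) in auto)
  then show ?thesis
    unfolding r(2) flip_pm_coset tensor_def pm_quotient.carrier_quot[OF tensor_quotient[OF B A]] carrier_free_tensor
    by blast
qed

section \<open>The twist by \<open>\<sigma>\<close> exchanges the tensor factors\<close>

text \<open>
  The twist \<open>\<sigma>\<close> leads from the algebra for \<open>q\<close> (prefix \<open>s\<close>, the source) to the one for \<open>q\<inverse>\<close> (prefix \<open>t\<close>, the target).
\<close>

locale sigma_twist =
  s: quantum_coproduct C d a q \<Delta> + t: quantum_coproduct C d a "inverse q" \<Delta>'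
  for C :: "'k::finite \<Rightarrow> 'k \<Rightarrow> int" and d a :: "'k \<Rightarrow> nat" and q :: complex
    and \<Delta> \<Delta>' :: "'k qelem \<Rightarrow> ('k qelem \<times> 'k qelem \<Rightarrow>\<^sub>0 complex) set" +
  fixes \<sigma> :: "'k qelem \<Rightarrow> 'k qelem"
  assumes sigma: "is_sigma C d a q \<sigma>"
begin

lemma \<sigma>_hom: "\<sigma> \<in> ring_hom s.U t.U"
  and \<sigma>_smult: "x \<in> carrier s.U \<Longrightarrow> \<sigma> (c \<odot>\<^bsub>s.U\<^esub> x) = c \<odot>\<^bsub>t.U\<^esub> \<sigma> x"
  and \<sigma>_K: "\<sigma> (s.k i) = t.k' i"
  and \<sigma>_E: "\<sigma> (s.e i) = (- 1) \<odot>\<^bsub>t.U\<^esub> (t.k' i \<otimes>\<^bsub>t.U\<^esub> t.e i)"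
  using sigma by (simp_all add: is_sigma_def Let_def alg_iso_def alg_hom_def t.a_inv_U)

lemmas \<sigma>_closed [simp] = ring_hom_closed[OF \<sigma>_hom]
  and \<sigma>_add = ring_hom_add[OF \<sigma>_hom]
  and \<sigma>_mult = ring_hom_mult[OF \<sigma>_hom]
  and \<sigma>_one = ring_hom_one[OF \<sigma>_hom]

text \<open>
  The value is forced, since \<open>\<sigma> (k\<^sub>i\<inverse>)\<close> is inverse to \<open>\<sigma> k\<^sub>i = k\<^sub>i\<inverse>\<close>.
\<close>

lemma \<sigma>_Kinv: "\<sigma> (s.k' i) = t.k i"
proof -
  have "\<sigma> (s.k' i) \<otimes>\<^bsub>t.U\<^esub> t.k' i = \<one>\<^bsub>t.U\<^esub>"
    using \<sigma>_mult[of "s.k' i" "s.k i"] by (simp add: s.Kinv_K \<sigma>_K \<sigma>_one)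
  then have "\<sigma> (s.k' i) \<otimes>\<^bsub>t.U\<^esub> (t.k' i \<otimes>\<^bsub>t.U\<^esub> t.k i) = t.k i"
    using t.U.m_assoc[of "\<sigma> (s.k' i)" "t.k' i" "t.k i"] by simp
  then show ?thesis by (simp add: t.Kinv_K)
qed

lemma \<sigma>_B: "x \<in> carrier s.B \<Longrightarrow> \<sigma> x \<in> carrier t.B"
proof (induction rule: s.Uqb_induct)
  case (E i)
  show ?case unfolding \<sigma>_E by (intro t.smult_in_B t.mult_in_B) simp_all
qed (simp_all add: \<sigma>_smult \<sigma>_one \<sigma>_K \<sigma>_Kinv \<sigma>_add \<sigma>_mult t.add_in_B t.mult_in_B s.B_subset_U)

text \<open>
  The map \<open>flip \<circ> (\<sigma> \<otimes> \<sigma>)\<close> on representatives.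
\<close>

abbreviation \<sigma>_swap :: "('k qelem \<times> 'k qelem \<Rightarrow>\<^sub>0 complex) \<Rightarrow> ('k qelem \<times> 'k qelem \<Rightarrow>\<^sub>0 complex)" where
  "\<sigma>_swap \<equiv> pm_push (\<lambda>(b, b'). (\<sigma> b', \<sigma> b))"

lemma \<sigma>_swap_mult:
  assumes "Poly_Mapping.keys p \<subseteq> carrier s.U \<times> carrier s.U" "Poly_Mapping.keys r \<subseteq> carrier s.U \<times> carrier s.U"
  shows "\<sigma>_swap (p \<otimes>\<^bsub>free_tensor s.U s.U\<^esub> r) = \<sigma>_swap p \<otimes>\<^bsub>free_tensor t.U t.U\<^esub> \<sigma>_swap r"
  unfolding free_tensor_def monoid.simps
proof (rule pm_push_pm_bilinear)
  fix u v assume "u \<in> Poly_Mapping.keys p" "v \<in> Poly_Mapping.keys r"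
  then have "u \<in> carrier s.U \<times> carrier s.U" "v \<in> carrier s.U \<times> carrier s.U" using assms by blast+
  then show "(\<lambda>(b, b'). (\<sigma> b', \<sigma> b)) ((\<lambda>(a, b) (a', b'). (a \<otimes>\<^bsub>s.U\<^esub> a', b \<otimes>\<^bsub>s.U\<^esub> b')) u v) =
      (\<lambda>(a, b) (a', b'). (a \<otimes>\<^bsub>t.U\<^esub> a', b \<otimes>\<^bsub>t.U\<^esub> b')) ((\<lambda>(b, b'). (\<sigma> b', \<sigma> b)) u) ((\<lambda>(b, b'). (\<sigma> b', \<sigma> b)) v)"
    by (simp add: case_prod_unfold mem_Times_iff \<sigma>_mult)
qed

lemma \<sigma>_swap_tensor_null:
  assumes "p \<in> tensor_null s.U s.U"
  shows "\<sigma>_swap p \<in> tensor_null t.U t.U"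
proof -
  have "\<sigma> \<in> lin_maps s.U t.U" by (simp add: lin_maps_def \<sigma>_add \<sigma>_smult)
  then have "pm_push (map_prod \<sigma> \<sigma>) p \<in> tensor_null t.U t.U" using assms by (intro pm_push_tensor_null)
  then have "Poly_Mapping.map_key prod.swap (pm_push (map_prod \<sigma> \<sigma>) p) \<in> tensor_null t.U t.U"
    using swap_tensor_null[of t.U t.U] by blast
  then show ?thesis
    by (simp add: map_key_swap_eq_pm_push lin_ext_comp case_prod_unfold prod.swap_def map_prod_def)
qed

text \<open>
  This is where the factor \<open>- k\<^sub>i\<inverse>\<close> in \<open>\<sigma> e\<^sub>i = - k\<^sub>i\<inverse> e\<^sub>i\<close> is needed. On the one side,
  \<open>\<Delta>' (- k\<^sub>i\<inverse> e\<^sub>i) = - (k\<^sub>i\<inverse> \<otimes> k\<^sub>i\<inverse>) (e\<^sub>i \<otimes> 1 + k\<^sub>i \<otimes> e\<^sub>i) = - k\<^sub>i\<inverse> e\<^sub>i \<otimes> k\<^sub>i\<inverse> - 1 \<otimes> k\<^sub>i\<inverse> e\<^sub>i\<close>.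
  On the other side, \<open>e\<^sub>i \<otimes> 1 + k\<^sub>i \<otimes> e\<^sub>i\<close> becomes \<open>1 \<otimes> (- k\<^sub>i\<inverse> e\<^sub>i) + (- k\<^sub>i\<inverse> e\<^sub>i) \<otimes> k\<^sub>i\<inverse>\<close>. As representatives the two
  differ by relations that move the sign out of a tensor factor.
\<close>

lemma \<sigma>_swap_\<Delta>_E: "\<sigma>_swap (Poly_Mapping.single (s.e i, \<one>\<^bsub>s.U\<^esub>) 1 + Poly_Mapping.single (s.k i, s.e i) 1) \<in> \<Delta>' (\<sigma> (s.e i))"
proof -
  let ?ke = "t.k' i \<otimes>\<^bsub>t.U\<^esub> t.e i" and ?s = "\<lambda>x y. Poly_Mapping.single (x, y) (1::complex)"
  have "pm_scale (- 1) (?s (t.k' i) (t.k' i) \<otimes>\<^bsub>free_tensor t.U t.U\<^esub> (?s (t.e i) \<one>\<^bsub>t.U\<^esub> + ?s (t.k i) (t.e i)))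
      \<in> \<Delta>' (\<sigma> (s.e i))"
    unfolding \<sigma>_E by (intro t.\<Delta>_smult t.\<Delta>_mult t.\<Delta>_Kinv t.\<Delta>_E) simp_all
  then have 1: "pm_scale (- 1) (?s ?ke (t.k' i) + ?s \<one>\<^bsub>t.U\<^esub> ?ke) \<in> \<Delta>' (\<sigma> (s.e i))"
    by (simp only: t.mult_single_free_tensor lin_ext.add lin_ext_single map_prod_simp t.Kinv_K
          t.U.r_one[OF t.gen_in_U] pm.scale_one)
  have 2: "?s ((- 1) \<odot>\<^bsub>t.U\<^esub> ?ke) (t.k' i) - pm_scale (- 1) (?s ?ke (t.k' i)) \<in> tensor_null t.U t.U"
    by (rule tensor_null_smult_left) simp_all
  have 3: "?s \<one>\<^bsub>t.U\<^esub> ((- 1) \<odot>\<^bsub>t.U\<^esub> ?ke) - pm_scale (- 1) (?s \<one>\<^bsub>t.U\<^esub> ?ke) \<in> tensor_null t.U t.U"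
    by (rule tensor_null_smult_right) simp_all
  have 4: "\<sigma>_swap (?s (s.e i) \<one>\<^bsub>s.U\<^esub> + ?s (s.k i) (s.e i)) =
      ?s \<one>\<^bsub>t.U\<^esub> ((- 1) \<odot>\<^bsub>t.U\<^esub> ?ke) + ?s ((- 1) \<odot>\<^bsub>t.U\<^esub> ?ke) (t.k' i)"
    by (simp only: lin_ext.add lin_ext_single case_prod_conv \<sigma>_E \<sigma>_K \<sigma>_one pm.scale_one)
  have "\<sigma>_swap (?s (s.e i) \<one>\<^bsub>s.U\<^esub> + ?s (s.k i) (s.e i)) - pm_scale (- 1) (?s ?ke (t.k' i) + ?s \<one>\<^bsub>t.U\<^esub> ?ke)
      \<in> tensor_null t.U t.U"
    using pm.subspace_add[OF subspace_tensor_null 2 3] unfolding 4 pm.scale_right_distrib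
    by (simp only: add_diff_add add.commute)
  then show ?thesis using t.\<Delta>_mem_iff[OF _ 1] by simp
qed

text \<open>
  The identity \<open>\<Delta>' \<circ> \<sigma> = flip \<circ> (\<sigma> \<otimes> \<sigma>) \<circ> \<Delta>\<close> on \<open>B\<close>. It is enough to find one representative of \<open>\<Delta> x\<close> for which
  it holds, because \<open>flip \<circ> (\<sigma> \<otimes> \<sigma>)\<close> preserves relations, and such representatives can be added and
  multiplied.
\<close>

lemma coproduct_\<sigma>:
  assumes "x \<in> carrier s.B" and p: "p \<in> \<Delta> x"
  shows "\<sigma>_swap p \<in> \<Delta>' (\<sigma> x)"
proof -
  have "\<exists>p. p \<in> \<Delta> x \<and> \<sigma>_swap p \<in> \<Delta>' (\<sigma> x)"
    using assms(1)
  proof (induction rule: s.Uqb_induct)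
    case (scalar c)
    have "pm_scale c (Poly_Mapping.single (\<one>\<^bsub>t.U\<^esub>, \<one>\<^bsub>t.U\<^esub>) 1) \<in> \<Delta>' (c \<odot>\<^bsub>t.U\<^esub> \<one>\<^bsub>t.U\<^esub>)"
      by (intro t.\<Delta>_smult t.\<Delta>_one) simp
    moreover have "pm_scale c (Poly_Mapping.single (\<one>\<^bsub>s.U\<^esub>, \<one>\<^bsub>s.U\<^esub>) 1) \<in> \<Delta> (c \<odot>\<^bsub>s.U\<^esub> \<one>\<^bsub>s.U\<^esub>)"
      by (intro s.\<Delta>_smult s.\<Delta>_one) simp
    ultimately show ?case
      by (intro exI[of _ "pm_scale c (Poly_Mapping.single (\<one>\<^bsub>s.U\<^esub>, \<one>\<^bsub>s.U\<^esub>) 1)"])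
         (simp add: \<sigma>_one \<sigma>_smult)
  next
    case (E i)
    show ?case using s.\<Delta>_E \<sigma>_swap_\<Delta>_E by blast
  next
    case (K i)
    show ?case
      by (intro exI[of _ "Poly_Mapping.single (s.k i, s.k i) 1"]) (simp add: \<sigma>_K s.\<Delta>_K t.\<Delta>_Kinv)
  next
    case (Kinv i)
    show ?case
      by (intro exI[of _ "Poly_Mapping.single (s.k' i, s.k' i) 1"]) (simp add: \<sigma>_Kinv s.\<Delta>_Kinv t.\<Delta>_K)
  next
    case (add x y)
    then obtain p r where "p \<in> \<Delta> x" "\<sigma>_swap p \<in> \<Delta>' (\<sigma> x)" "r \<in> \<Delta> y" "\<sigma>_swap r \<in> \<Delta>' (\<sigma> y)" by blast
    then show ?case
      using add.hyps s.B_subset_U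
      by (intro exI[of _ "p + r"]) (simp add: \<sigma>_add lin_ext.add s.\<Delta>_add t.\<Delta>_add)
  next
    case (mult x y)
    then obtain p r where pr: "p \<in> \<Delta> x" "\<sigma>_swap p \<in> \<Delta>' (\<sigma> x)" "r \<in> \<Delta> y" "\<sigma>_swap r \<in> \<Delta>' (\<sigma> y)" by blast
    have xy: "x \<in> carrier s.U" "y \<in> carrier s.U" using mult.hyps s.B_subset_U by blast+
    show ?case
    proof (intro exI conjI)
      show "p \<otimes>\<^bsub>free_tensor s.U s.U\<^esub> r \<in> \<Delta> (x \<otimes>\<^bsub>s.U\<^esub> y)" by (rule s.\<Delta>_mult[OF xy pr(1,3)])
      show "\<sigma>_swap (p \<otimes>\<^bsub>free_tensor s.U s.U\<^esub> r) \<in> \<Delta>' (\<sigma> (x \<otimes>\<^bsub>s.U\<^esub> y))"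
        unfolding \<sigma>_swap_mult[OF s.\<Delta>_keys[OF xy(1) pr(1)] s.\<Delta>_keys[OF xy(2) pr(3)]] \<sigma>_mult[OF xy]
        by (rule t.\<Delta>_mult) (use xy pr in simp_all)
    qed
  qed
  then obtain p0 where p0: "p0 \<in> \<Delta> x" "\<sigma>_swap p0 \<in> \<Delta>' (\<sigma> x)" by blast
  have x: "x \<in> carrier s.U" by (rule s.B_subset_U[OF assms(1)])
  have "p - p0 \<in> tensor_null s.U s.U" using s.\<Delta>_mem_iff[OF x p0(1)] p by simp
  then have "\<sigma>_swap p - \<sigma>_swap p0 \<in> tensor_null t.U t.U"
    using \<sigma>_swap_tensor_null by (simp add: lin_ext.diff[symmetric])
  then show ?thesis using t.\<Delta>_mem_iff[OF \<sigma>_closed[OF x] p0(2)] by simp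
qed

lemma alg_module_pullback:
  assumes V: "alg_module t.B V"
  shows "alg_module s.B (pullback \<sigma> V)"
proof -
  have "Module.module complex_ring (pullback \<sigma> V)"
    by (rule module_same_ops[of _ V]) (use V in \<open>simp_all add: alg_module_def pullback_def\<close>)
  then show ?thesis
    using V unfolding alg_module_def
    by (simp add: pullback_def \<sigma>_B \<sigma>_add \<sigma>_smult \<sigma>_mult \<sigma>_one s.B_subset_U)
qed

text \<open>
  For a representative \<open>p\<close> of \<open>\<Delta> x\<close>, exchanging the factors of \<open>(\<sigma> \<otimes> \<sigma>) p\<close> and those of a tensor exchanges the factors
  of the result; by \<open>coproduct_\<sigma>\<close> the exchanged element represents \<open>\<Delta>' (\<sigma> x)\<close>.
\<close>

lemma flip_act:
  assumes V: "alg_module t.B V" and W: "alg_module t.B W"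
    and x: "x \<in> carrier s.B" and r: "Poly_Mapping.keys r \<subseteq> carrier V \<times> carrier W"
  shows "flip (act (O_tensor C d a q \<Delta> (pullback \<sigma> V) (pullback \<sigma> W)) x (pm_coset (tensor_null V W) r)) =
    act (pullback \<sigma> (O_tensor C d a (inverse q) \<Delta>' W V)) x (flip (pm_coset (tensor_null V W) r))"
proof -
  have null: "tensor_null (pullback \<sigma> V) (pullback \<sigma> W) = tensor_null V W"
    by (simp add: tensor_null_def bilinear_rels_def pullback_def)
  obtain p where p: "p \<in> restrict_coproduct s.B \<Delta> x" using s.D.D_nonempty[OF x] by blast
  then have p': "p \<in> \<Delta> x" "Poly_Mapping.keys p \<subseteq> carrier s.B \<times> carrier s.B"
    by (simp_all add: s.mem_restrict_coproduct)
  let ?g = "\<lambda>(b, b') (v, w). (act V (\<sigma> b) v, act W (\<sigma> b') w)"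
  let ?g' = "\<lambda>(b, b') (w, v). (act W b w, act V b' v)"
  have rr: "Poly_Mapping.keys r \<subseteq> carrier (pullback \<sigma> V) \<times> carrier (pullback \<sigma> W)"
    using r by (simp add: pullback_def)
  have lhs: "act (O_tensor C d a q \<Delta> (pullback \<sigma> V) (pullback \<sigma> W)) x (pm_coset (tensor_null V W) r) =
      pm_coset (tensor_null V W) (pm_bilinear ?g p r)"
    using s.D.act_tensor_amodule[OF alg_module_pullback[OF V] alg_module_pullback[OF W] x p rr]
    unfolding null O_tensor_def by (simp add: pullback_def)
  have "Poly_Mapping.keys (\<sigma>_swap p) \<subseteq> carrier t.B \<times> carrier t.B"
    using p'(2) \<sigma>_B by (intro subset_trans[OF keys_pm_push]) auto
  then have "\<sigma>_swap p \<in> restrict_coproduct t.B \<Delta>' (\<sigma> x)"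
    using coproduct_\<sigma>[OF x p'(1)] by (simp add: t.mem_restrict_coproduct)
  moreover have "Poly_Mapping.keys (pm_push prod.swap r) \<subseteq> carrier W \<times> carrier V"
    using r by (intro subset_trans[OF keys_pm_push]) auto
  ultimately have rhs: "act (pullback \<sigma> (O_tensor C d a (inverse q) \<Delta>' W V)) x
      (pm_coset (tensor_null W V) (pm_push prod.swap r)) =
      pm_coset (tensor_null W V) (pm_bilinear ?g' (\<sigma>_swap p) (pm_push prod.swap r))"
    using t.D.act_tensor_amodule[OF W V \<sigma>_B[OF x]] unfolding O_tensor_def by (simp add: pullback_def)
  have "pm_push prod.swap (pm_bilinear ?g p r) = pm_bilinear ?g' (\<sigma>_swap p) (pm_push prod.swap r)"
    by (rule pm_push_pm_bilinear) (simp add: case_prod_unfold prod.swap_def)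
  then show ?thesis unfolding lhs flip_pm_coset rhs by simp
qed

theorem amodule_iso_flip:
  assumes V: "alg_module t.B V" and W: "alg_module t.B W"
  shows "amodule_iso s.B (O_tensor C d a q \<Delta> (pullback \<sigma> V) (pullback \<sigma> W))
    (pullback \<sigma> (O_tensor C d a (inverse q) \<Delta>' W V)) flip"
    (is "amodule_iso _ ?M ?N flip")
proof -
  have modV: "Module.module complex_ring V" and modW: "Module.module complex_ring W"
    using V W by (simp_all add: alg_module_def)
  interpret VW: pm_quotient "free_tensor V W" "tensor_null V W"
    by (rule tensor_quotient[OF modV modW])
  interpret WV: pm_quotient "free_tensor W V" "tensor_null W V"
    by (rule tensor_quotient[OF modW modV])
  have "tensor (pullback \<sigma> V) (pullback \<sigma> W) = tensor V W"
    by (simp add: tensor_def tensor_null_def bilinear_rels_def free_tensor_def pullback_def)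
  then have M: "carrier ?M = carrier (tensor V W)" "ring.add ?M = ring.add (tensor V W)"
      "module.smult ?M = module.smult (tensor V W)"
    and N: "carrier ?N = carrier (tensor W V)" "ring.add ?N = ring.add (tensor W V)"
      "module.smult ?N = module.smult (tensor W V)"
    by (simp_all add: O_tensor_def tensor_amodule_def pullback_def module.defs amodule.defs)
  have coset: "\<exists>r. Poly_Mapping.keys r \<subseteq> carrier V \<times> carrier W \<and> t = pm_coset (tensor_null V W) r"
    if "t \<in> carrier (tensor V W)" for t
    using that by (auto simp: tensor_def VW.carrier_quot carrier_free_tensor)
  show ?thesis
    unfolding amodule_iso_def
  proof (intro conjI ballI allI)
    show "alg_module s.B ?M"
      unfolding O_tensor_def by (intro s.D.alg_module_tensor_amodule alg_module_pullback V W)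
    show "alg_module s.B ?N"
      unfolding O_tensor_def by (intro alg_module_pullback t.D.alg_module_tensor_amodule V W)
    show "bij_betw flip (carrier ?M) (carrier ?N)"
      unfolding M N by (rule bij_betw_byWitness[of _ flip]) (use flip_carrier[OF modV modW] flip_carrier[OF modW modV] in \<open>auto simp: flip_flip\<close>)
  next
    fix v w assume "v \<in> carrier ?M" "w \<in> carrier ?M"
    then obtain r r' where "v = pm_coset (tensor_null V W) r" "w = pm_coset (tensor_null V W) r'"
      unfolding M using coset by metis
    then show "flip (v \<oplus>\<^bsub>?M\<^esub> w) = flip v \<oplus>\<^bsub>?N\<^esub> flip w"
      by (simp only: M N tensor_def VW.add_quot WV.add_quot flip_pm_coset lin_ext.add)
  next
    fix c v assume "v \<in> carrier ?M"
    then obtain r where "v = pm_coset (tensor_null V W) r" unfolding M using coset by metis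
    then show "flip (c \<odot>\<^bsub>?M\<^esub> v) = c \<odot>\<^bsub>?N\<^esub> flip v"
      by (simp only: M N tensor_def VW.smult_quot WV.smult_quot flip_pm_coset lin_ext.scale)
  next
    fix x v assume "x \<in> carrier s.B" "v \<in> carrier ?M"
    then show "flip (act ?M x v) = act ?N x (flip v)"
      using coset[of v] flip_act[OF V W] unfolding M by blast
  qed
qed

end

theorem theorem3p4:
  fixes C :: "'i::finite option \<Rightarrow> 'i option \<Rightarrow> int"
    and d a :: "'i option \<Rightarrow> nat"
    and h q :: complex
    and \<Delta> \<Delta>' :: "'i option qelem \<Rightarrow> ('i option qelem \<times> 'i option qelem \<Rightarrow>\<^sub>0 complex) set"
    and \<sigma> :: "'i option qelem \<Rightarrow> 'i option qelem"
    and V :: "('i option qelem, 'v) amodule"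
    and W :: "('i option qelem, 'w) amodule"
  assumes "untwisted_affine_datum C d a"
    and "q = exp h"
    and "\<forall>m>0. q ^ m \<noteq> 1"
    and "is_coproduct C d a q \<Delta>"
    and "is_coproduct C d a (inverse q) \<Delta>'"
    and "is_sigma C d a q \<sigma>"
    and "in_category_O C d a (- h) V"
    and "in_category_O C d a (- h) W"
  shows "amodule_iso (Uqb C d a q)
           (O_tensor C d a q \<Delta> (pullback \<sigma> V) (pullback \<sigma> W))
           (pullback \<sigma> (O_tensor C d a (inverse q) \<Delta>' W V))
           flip"
proof -
  interpret sigma_twist C d a q \<Delta> \<Delta>' \<sigma>
    using assms by (simp add: sigma_twist_def sigma_twist_axioms_def quantum_coproduct_def)
  have "alg_module t.B V" "alg_module t.B W"
    using assms by (simp_all add: in_category_O_def Let_def exp_minus)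
  then show ?thesis by (rule amodule_iso_flip)
qed

end
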